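(* Let $\ell\in\frac12\mathbb{N}$ and let $R_n$ ($n\ge0$) be the rescaled monic matrix-valued orthogonal polynomials defined in the context. For $\alpha\in\mathbb{R}$ let $C_\alpha,U_\alpha,V_\alpha$ and $\lambda^\alpha_n(i)$ be as in the context. Then the monic matrix-valued orthogonal polynomials $R_n$ can be written, for $i,j\in\{0,\dots,2\ell\}$, as $$\bigl(R_n(u)\bigr)_{ij}=\left({}_2H_1\!\left({U_\alpha^t,\;V_\alpha^t+\lambda^\alpha_n(i)\atop C_\alpha^t};u\right)\,n!\,\bigl[C_\alpha^t,U_\alpha^t,V_\alpha^t+\lambda^\alpha_n(i)\bigr]_n^{-1}e_i\right)^t_j$$ for all $\alpha\in\mathbb{R}$, where $e_i$ is the standard basis vector.
   Context: $\mathbb{N}=\{0,1,2,\dots\}$; matrices are $(2\ell+1)\times(2\ell+1)$, indexed by $0,\dots,2\ell$; $E_{ij}$ are the matrix units ($0$ if an index is out of range); $(a)_k$ is the Pochhammer symbol; $U_r(x)$ in the weight below is the Chebyshev polynomial of the second kind; scalars are identified with multiples of $I$; $^t$ denotes transpose. Weight and polynomials: for $0\le m\le n\le2\ell$, $x\in[-1,1]$, $$W(x)_{n,m}=\sqrt{1-x^2}\sum_{t=0}^m\alpha_t(m,n)U_{n+m-2t}(x),\quad \alpha_t(m,n)=\frac{2\ell+1}{n+1}\frac{(2\ell-m)!\,m!}{(2\ell)!}(-1)^{m-t}\frac{(n-2\ell)_{m-t}}{(n+2)_{m-t}}\frac{(2\ell+2-t)_t}{t!},$$ and $W(x)_{n,m}=W(x)_{m,n}$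 for $n<m$. $P_n$ is the unique monic (leading coefficient $I$) matrix-valued polynomial of degree $n$ with $\int_{-1}^1P_n(x)W(x)P_m(x)^*\,dx=0$ for $n\neq m$, and $R_n(u)=(-1)^n2^{-n}P_n(1-2u)$, which is monic in $u$. Matrices: $C_\alpha=C+\alpha B_0$, $U_\alpha=U-\alpha B_1$, $V_\alpha=V-\alpha A_0$, where $$C=-\sum_i\tfrac{2\ell-i}{2}E_{i,i+1}+\sum_i\tfrac{2\ell+3}{2}E_{ii}-\sum_i\tfrac i2E_{i,i-1},\quad U=(2\ell+3)I,\quad V=-\sum_ii(2\ell-i)E_{ii},$$ $$B_0=-\sum_i\tfrac{2\ell-i}{4\ell}E_{i,i+1}+\sum_i\tfrac{\ell-i}{2\ell}E_{ii}+\sum_i\tfrac{i}{4\ell}E_{i,i-1},\quad B_1=-\sum_i\tfrac{\ell-i}{\ell}E_{ii},\quad A_0=\sum_i\tfrac{(2\ell+2)(i-2\ell)}{2\ell}E_{ii},$$ all sums over $0\le i\le2\ell$. Further $$\lambda^\alpha_n(i)=-n(n-1)-n(2\ell+3)+i(2\ell-i)+\alpha\Bigl(-\tfrac{n(\ell-i)}{\ell}+\tfrac{(2\ell+2)(i-2\ell)}{2\ell}\Bigr).$$ In the scalar case $\ell=0$ the terms multiplied by $\alpha$ (which come from a first-order differential operator that has no analogue for $\ell=0$) are absent, i.e. $C_\alpha=\frac32$, $U_\alpha=3$, $V_\alpha=0$, $\lambda^\alpha_n(0)=-n(n+2)$. Tirao's matrix-valued hypergeometric function: for $d\times d$ matrices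 $C,U,V$ with no eigenvalue of $C$ in $-\mathbb{N}$, $${}_2H_1\!\left({U,V\atop C};z\right)=\sum_{i=0}^\infty\frac{z^i}{i!}[C,U,V]_i,\quad [C,U,V]_0=I,\quad [C,U,V]_{i+1}=(C+i)^{-1}\bigl(i^2+i(U-1)+V\bigr)[C,U,V]_i ,$$ convergent for $|z|<1$. (The eigenvalues of $C_\alpha$ are $(2j+3)/2$, $j\in\{0,\dots,2\ell\}$, hence not in $-\mathbb{N}$.)
   Formalization: The inverse of the bracket [...]_n does not exist for some real α (e.g. ℓ=1/2, n=1, i=0, α=-4), so the identity is stated for every α where it exists, and for every real α as the limit of the right-hand side as the parameter tends to α. *)

theory Defs
  imports
    "HOL-Analysis.Analysis"
    "Jordan_Normal_Form.Schur_Decomposition"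
    "Jordan_Normal_Form.Gauss_Jordan_Elimination"
begin

unbundle no vec_syntax

text \<open>The spin \<open>\<ell> \<in> \<one>/2 \<nat>\<close> is represented by the natural number \<open>N = 2\<ell>\<close>; all matrices
  are square of size \<open>N + 1 = 2\<ell> + 1\<close>, with rows and columns indexed by \<open>0, \<dots>, N\<close>.\<close>

abbreviation ell :: "nat \<Rightarrow> real" where
  "ell N \<equiv> real N / 2"

definition cmat :: "nat \<Rightarrow> (nat \<Rightarrow> nat \<Rightarrow> real) \<Rightarrow> complex mat" where
  "cmat N f = mat (N + 1) (N + 1) (\<lambda>(i, j). complex_of_real (f i j))"

definition scalar_mat :: "nat \<Rightarrow> complex \<Rightarrow> complex mat" where
  "scalar_mat d c = c \<cdot>\<^sub>m 1\<^sub>m d"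

text \<open>Only meaningful for invertible \<open>A\<close>.\<close>

definition minv :: "complex mat \<Rightarrow> complex mat" where
  "minv A = the (mat_inverse A)"


section \<open>The weight and the orthogonal polynomials\<close>

text \<open>Chebyshev polynomials of the second kind.\<close>

fun chebU :: "nat \<Rightarrow> real \<Rightarrow> real" where
  "chebU 0 x = 1"
| "chebU (Suc 0) x = 2 * x"
| "chebU (Suc (Suc r)) x = 2 * x * chebU (Suc r) x - chebU r x"

text \<open>Below \<open>t \<le> m \<le> n \<le> N\<close>, so no subtraction of natural numbers is truncated.\<close>

definition weight_coeff :: "nat \<Rightarrow> nat \<Rightarrow> nat \<Rightarrow> nat \<Rightarrow> real" where
  "weight_coeff N t m n =
     (2 * ell N + 1) / (real n + 1) * (fact (N - m) * fact m / fact N) * (-1) ^ (m - t)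
     * (pochhammer (real n - 2 * ell N) (m - t) / pochhammer (real n + 2) (m - t))
     * (pochhammer (2 * ell N + 2 - real t) t / fact t)"

definition weight_entry :: "nat \<Rightarrow> real \<Rightarrow> nat \<Rightarrow> nat \<Rightarrow> real" where
  "weight_entry N x n m =
     sqrt (1 - x\<^sup>2) * (\<Sum>t\<le>m. weight_coeff N t m n * chebU (n + m - 2 * t) x)"

definition weight :: "nat \<Rightarrow> real \<Rightarrow> complex mat" where
  "weight N x = cmat N (\<lambda>n m. if m \<le> n then weight_entry N x n m else weight_entry N x m n)"

text \<open>A matrix-valued polynomial is a matrix with polynomial entries.\<close>

definition eval_mat :: "complex poly mat \<Rightarrow> complex \<Rightarrow> complex mat" where
  "eval_mat P x = map_mat (\<lambda>p. poly p x) P"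

definition monic_mat_poly :: "nat \<Rightarrow> nat \<Rightarrow> complex poly mat \<Rightarrow> bool" where
  "monic_mat_poly d n P \<longleftrightarrow>
     P \<in> carrier_mat d d \<and> (\<forall>i<d. \<forall>j<d. degree (P $$ (i, j)) \<le> n) \<and>
     map_mat (\<lambda>p. coeff p n) P = 1\<^sub>m d"

text \<open>The matrix-valued integral is taken entrywise.\<close>

definition monic_mvop :: "nat \<Rightarrow> (nat \<Rightarrow> complex poly mat) \<Rightarrow> bool" where
  "monic_mvop N P \<longleftrightarrow>
     (\<forall>n. monic_mat_poly (N + 1) n (P n)) \<and>
     (\<forall>n m. n \<noteq> m \<longrightarrow> (\<forall>i\<le>N. \<forall>j\<le>N.
        ((\<lambda>x. (eval_mat (P n) (of_real x) * weight N x * mat_adjoint (eval_mat (P m) (of_real x)))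
               $$ (i, j)) has_integral 0) {-1..1}))"

definition R_poly :: "(nat \<Rightarrow> complex poly mat) \<Rightarrow> nat \<Rightarrow> complex \<Rightarrow> complex mat" where
  "R_poly P n u = ((-1) ^ n / 2 ^ n) \<cdot>\<^sub>m eval_mat (P n) (1 - 2 * u)"


section \<open>The parameter matrices and the eigenvalues\<close>

text \<open>For \<open>N = 0\<close> every term multiplied by \<open>\<alpha>\<close> is a quotient with denominator \<open>0\<close>, hence \<open>0\<close>
  in HOL. This is the intended convention that the \<open>\<alpha>\<close>-terms are absent in the scalar case;
  see \<open>scalar_case\<close> below.\<close>

definition C_mat :: "nat \<Rightarrow> complex mat" where
  "C_mat N = cmat N (\<lambda>i j.
     if j = i + 1 then - ((2 * ell N - real i) / 2)
     else if j = i then (2 * ell N + 3) / 2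
     else if i = j + 1 then - (real i / 2)
     else 0)"

definition U_mat :: "nat \<Rightarrow> complex mat" where
  "U_mat N = cmat N (\<lambda>i j. if j = i then 2 * ell N + 3 else 0)"

definition V_mat :: "nat \<Rightarrow> complex mat" where
  "V_mat N = cmat N (\<lambda>i j. if j = i then - (real i * (2 * ell N - real i)) else 0)"

definition B0_mat :: "nat \<Rightarrow> complex mat" where
  "B0_mat N = cmat N (\<lambda>i j.
     if j = i + 1 then - ((2 * ell N - real i) / (4 * ell N))
     else if j = i then (ell N - real i) / (2 * ell N)
     else if i = j + 1 then real i / (4 * ell N)
     else 0)"

definition B1_mat :: "nat \<Rightarrow> complex mat" where
  "B1_mat N = cmat N (\<lambda>i j. if j = i then - ((ell N - real i) / ell N) else 0)"

definition A0_mat :: "nat \<Rightarrow> complex mat" where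
  "A0_mat N = cmat N (\<lambda>i j.
     if j = i then (2 * ell N + 2) * (real i - 2 * ell N) / (2 * ell N) else 0)"

definition C_alpha :: "nat \<Rightarrow> real \<Rightarrow> complex mat" where
  "C_alpha N \<alpha> = C_mat N + complex_of_real \<alpha> \<cdot>\<^sub>m B0_mat N"

definition U_alpha :: "nat \<Rightarrow> real \<Rightarrow> complex mat" where
  "U_alpha N \<alpha> = U_mat N - complex_of_real \<alpha> \<cdot>\<^sub>m B1_mat N"

definition V_alpha :: "nat \<Rightarrow> real \<Rightarrow> complex mat" where
  "V_alpha N \<alpha> = V_mat N - complex_of_real \<alpha> \<cdot>\<^sub>m A0_mat N"

definition eigval :: "nat \<Rightarrow> real \<Rightarrow> nat \<Rightarrow> nat \<Rightarrow> real" where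
  "eigval N \<alpha> n i =
     - (real n * (real n - 1)) - real n * (2 * ell N + 3) + real i * (2 * ell N - real i)
     + \<alpha> * (- (real n * (ell N - real i) / ell N)
            + (2 * ell N + 2) * (real i - 2 * ell N) / (2 * ell N))"

lemma scalar_case:
  "C_alpha 0 \<alpha> = scalar_mat 1 (3 / 2)"
  "U_alpha 0 \<alpha> = scalar_mat 1 3"
  "V_alpha 0 \<alpha> = scalar_mat 1 0"
  "eigval 0 \<alpha> n 0 = - (real n * (real n + 2))"
  by (auto simp: C_alpha_def U_alpha_def V_alpha_def C_mat_def U_mat_def V_mat_def B0_mat_def
      B1_mat_def A0_mat_def cmat_def scalar_mat_def eigval_def algebra_simps)


section \<open>Tirao's matrix-valued hypergeometric function\<close>

primrec tirao_coeff :: "complex mat \<Rightarrow> complex mat \<Rightarrow> complex mat \<Rightarrow> nat \<Rightarrow> complex mat" where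
  "tirao_coeff C U V 0 = 1\<^sub>m (dim_row C)"
| "tirao_coeff C U V (Suc k) =
     minv (C + scalar_mat (dim_row C) (of_nat k))
     * (scalar_mat (dim_row C) (of_nat k ^ 2) + of_nat k \<cdot>\<^sub>m (U - 1\<^sub>m (dim_row C)) + V)
     * tirao_coeff C U V k"

text \<open>The series is summed entrywise; it converges for \<open>norm z < 1\<close>.\<close>

definition tirao_2H1 :: "complex mat \<Rightarrow> complex mat \<Rightarrow> complex mat \<Rightarrow> complex \<Rightarrow> complex mat" where
  "tirao_2H1 U V C z =
     mat (dim_row C) (dim_row C)
       (\<lambda>(i, j). \<Sum>k. z ^ k / fact k * tirao_coeff C U V k $$ (i, j))"

definition V_shift :: "nat \<Rightarrow> real \<Rightarrow> nat \<Rightarrow> nat \<Rightarrow> complex mat" where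
  "V_shift N \<alpha> n i =
     transpose_mat (V_alpha N \<alpha>) + scalar_mat (N + 1) (complex_of_real (eigval N \<alpha> n i))"

text \<open>The matrix \<open>[C\<^sub>\<alpha>\<^sup>t, U\<^sub>\<alpha>\<^sup>t, V\<^sub>\<alpha>\<^sup>t + \<lambda>\<^sub>n\<^sup>\<alpha>(i)]\<^sub>n\<close>. It is singular exactly when
  \<open>\<lambda>\<^sub>n\<^sup>\<alpha>(i) = \<lambda>\<^sub>k\<^sup>\<alpha>(j)\<close> for some \<open>k < n\<close> and \<open>j \<le> N\<close>, which does happen for some real \<open>\<alpha>\<close>, for
  example for \<open>N = 1\<close>, \<open>n = 1\<close>, \<open>i = 0\<close>, \<open>\<alpha> = -4\<close>.\<close>

definition bracket_n :: "nat \<Rightarrow> real \<Rightarrow> nat \<Rightarrow> nat \<Rightarrow> complex mat" where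
  "bracket_n N \<alpha> n i =
     tirao_coeff (transpose_mat (C_alpha N \<alpha>)) (transpose_mat (U_alpha N \<alpha>)) (V_shift N \<alpha> n i) n"

definition hyp_vec :: "nat \<Rightarrow> real \<Rightarrow> nat \<Rightarrow> nat \<Rightarrow> complex \<Rightarrow> complex vec" where
  "hyp_vec N \<alpha> n i u =
     tirao_2H1 (transpose_mat (U_alpha N \<alpha>)) (V_shift N \<alpha> n i) (transpose_mat (C_alpha N \<alpha>)) u
     *\<^sub>v ((fact n \<cdot>\<^sub>m minv (bracket_n N \<alpha> n i)) *\<^sub>v unit_vec (N + 1) i)"

end

theory Submission
  imports Defs
begin

text \<open>Put \<open>N = 2\<ell>\<close> and let \<open>D\<^sub>\<alpha>\<close> be the operator \<open>F \<mapsto> u (1 - u) F'' + F' (C\<^sub>\<alpha> - u U\<^sub>\<alpha>) - F V\<^sub>\<alpha>\<close> on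
  row vectors of polynomials. It does not raise degrees, and it multiplies the leading coefficient
  \<open>e\<^sub>i\<close> of a row of degree \<open>n\<close> by \<open>\<lambda>\<^sub>n\<^sup>\<alpha>(i)\<close>. If \<open>D\<^sub>\<alpha>\<close> is symmetric for the pairing \<open>\<integral> F W G\<^sup>*\<close>
  and the pairing is definite, then row \<open>i\<close> of \<open>R\<^sub>n\<close> is an eigenfunction with this eigenvalue: the
  difference between its image and its multiple has degree less than \<open>n\<close> and is orthogonal to all
  rows of degree less than \<open>n\<close> (\<open>monic_mvop_eigen\<close>). The transposed equation is Tirao's
  hypergeometric equation with the parameters \<open>C\<^sub>\<alpha>\<^sup>t, U\<^sub>\<alpha>\<^sup>t, V\<^sub>\<alpha>\<^sup>t + \<lambda>\<^sub>n\<^sup>\<alpha>(i)\<close>. Its polynomial solution is determined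
  by the value at \<open>u = 0\<close>, and this value is determined by the leading coefficient \<open>e\<^sub>i\<close>, provided that the
  bracket of index \<open>n\<close> is invertible (\<open>R_poly_eq_hyp_vec\<close>). The numerators in the recursion for the
  brackets are diagonal matrices with the entries \<open>\<lambda>\<^sub>n\<^sup>\<alpha>(i) - \<lambda>\<^sub>k\<^sup>\<alpha>(j)\<close>, \<open>k < n\<close>, and such an entry vanishes for
  at most one \<open>\<alpha>\<close>. This gives the identity near every \<open>\<alpha>\<close>, except possibly at \<open>\<alpha>\<close> itself.

  Symmetry and definiteness both rest on a simple form of the weight. The coefficients \<open>\<alpha>\<^sub>t(m, n)\<close>
  simplify to products of two binomial coefficients, so that for \<open>x = cos \<theta>\<close> each entry of \<open>W\<close> is, up to
  normalization, a sum \<open>\<Sum>t\<le>m. c\<^sub>t c\<^sub>s\<^sub>+\<^sub>1\<^sub>-\<^sub>t sin ((s + 1 - 2 t) \<theta>)\<close> with \<open>s = n + m\<close> and \<open>c\<^sub>t = (N + 1) choose t\<close>. Along an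
  antidiagonal \<open>n + m = s\<close> these sums differ only in their number of summands. This has two consequences.

  \<^item> The same recursion along antidiagonals holds for the Gram matrix of the coefficient vectors of
    \<open>(1 + a z)\<^sup>j (1 + a / z)\<^sup>N\<^sup>-\<^sup>j\<close>, \<open>z = cis \<theta>\<close>, where it comes from a telescoping geometric sum. So \<open>W\<close> is
    \<open>sin \<theta>\<close> times a Gram matrix; it is symmetric, and positive definite because the products form a basis
    (\<open>sinesum_gram\<close>, \<open>gram_vec_separating\<close>).

  \<^item> The symmetry of \<open>D\<^sub>\<alpha>\<close> amounts to a first-order equation for \<open>W\<close> and one for the skew part of
    \<open>(C\<^sub>\<alpha> - u U\<^sub>\<alpha>) W\<close> (\<open>weight_pearson_equation\<close>, \<open>weight_second_order_equation\<close>). Entrywise they are four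
    identities between sine sums of neighbouring antidiagonals, and the recursion proves these by
    induction. All boundary terms vanish, because \<open>W\<close> has the factor \<open>sqrt (1 - x\<^sup>2)\<close>.

  That the matrices \<open>C\<^sub>\<alpha> + k\<close> are invertible is seen by conjugation with the Pascal matrix, which makes
  \<open>C\<^sub>\<alpha>\<close> triangular for all \<open>\<alpha>\<close> at once (\<open>C_entry_pascal\<close>).\<close>


section \<open>Sine sums and their contiguous relations\<close>

text \<open>The entry \<open>W(cos \<theta>)\<^sub>n\<^sub>m\<close> of the weight, multiplied by
  \<open>(N choose n) * (N choose m)\<close>, is \<open>sinesum (N + 1) \<theta> (n + 1) (m + 1)\<close>. The shift of both
  indices by one makes the neighbours of a boundary entry available, and they vanish. The recursion
  runs along an antidiagonal, on which the summands of the closed form \<open>sinesum_closed\<close> do not change; all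
  identities below are proved by following it, that is, by induction on \<open>m\<close> for all \<open>n\<close>.\<close>
primrec sinesum :: "nat \<Rightarrow> real \<Rightarrow> nat \<Rightarrow> nat \<Rightarrow> real" where
  "sinesum M \<theta> n 0 = 0"
| "sinesum M \<theta> n (Suc m) = sinesum M \<theta> (Suc n) m
     + real (M choose n) * real (M choose m) * sin ((real n - real m) * \<theta>)"

primrec sinesum_deriv :: "nat \<Rightarrow> real \<Rightarrow> nat \<Rightarrow> nat \<Rightarrow> real" where
  "sinesum_deriv M \<theta> n 0 = 0"
| "sinesum_deriv M \<theta> n (Suc m) = sinesum_deriv M \<theta> (Suc n) m
     + real (M choose n) * real (M choose m) * ((real n - real m) * cos ((real n - real m) * \<theta>))"

lemma has_real_derivative_sinesum [derivative_intros]: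
  "((\<lambda>\<theta>. sinesum M \<theta> n m) has_real_derivative sinesum_deriv M \<theta> n m) (at \<theta> within A)"
  by (induction m arbitrary: n) (auto intro!: derivative_eq_intros)

lemma choose_Suc_mult:
  "(real k + 1) * real (M choose Suc k) = (real M - real k) * real (M choose k)"
proof -
  have "real (Suc k * (M choose Suc k)) = real ((M - k) * (M choose k))"
    by (metis binomial_absorption binomial_absorb_comp)
  moreover have "real ((M - k) * (M choose k)) = (real M - real k) * real (M choose k)"
    by (cases "k \<le> M") (auto simp: of_nat_diff)
  ultimately show ?thesis by (simp add: algebra_simps)
qed

text \<open>Multiplication by \<open>cos \<theta>\<close> and by \<open>sin \<theta>\<close> shifts the frequency by one in both
  directions; this turns each identity between sine sums into identities between coefficients.\<close>
lemma trig_shift: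
  fixes k \<theta> :: real
  shows "2 * cos \<theta> * sin (k * \<theta>) = sin ((k + 1) * \<theta>) + sin ((k - 1) * \<theta>)"
    "2 * cos \<theta> * cos (k * \<theta>) = cos ((k + 1) * \<theta>) + cos ((k - 1) * \<theta>)"
    "2 * sin \<theta> * sin (k * \<theta>) = cos ((k - 1) * \<theta>) - cos ((k + 1) * \<theta>)"
    "2 * sin \<theta> * cos (k * \<theta>) = sin ((k + 1) * \<theta>) - sin ((k - 1) * \<theta>)"
  by (simp_all add: sin_add sin_diff cos_add cos_diff algebra_simps)

context
  fixes M :: nat and \<theta> :: real
begin

private abbreviation "c k \<equiv> real (M choose k)"

lemma choose_rec:
  "(real n + 1) * c (Suc n) = (real M - real n) * c n"
  "(real n + 2) * c (Suc (Suc n)) = (real M - real n - 1) * c (Suc n)"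
  using choose_Suc_mult[of n M] choose_Suc_mult[of "Suc n" M] by (simp_all add: algebra_simps)

lemma sinesum_steps:
  "sinesum M \<theta> (Suc (Suc n)) (Suc (Suc m)) = sinesum M \<theta> (Suc (Suc (Suc n))) (Suc m)
      + c (Suc (Suc n)) * c (Suc m) * sin ((real n + 1 - real m) * \<theta>)"
  "sinesum M \<theta> (Suc n) (Suc m) = sinesum M \<theta> (Suc (Suc n)) m
      + c (Suc n) * c m * sin ((real n + 1 - real m) * \<theta>)"
  "sinesum M \<theta> (Suc n) (Suc (Suc m)) = sinesum M \<theta> (Suc (Suc n)) (Suc m)
      + c (Suc n) * c (Suc m) * sin ((real n - real m) * \<theta>)"
  by (simp_all add: algebra_simps)

lemma sinesum_deriv_steps:
  "sinesum_deriv M \<theta> (Suc (Suc n)) (Suc (Suc m)) = sinesum_deriv M \<theta> (Suc (Suc (Suc n))) (Suc m)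
      + c (Suc (Suc n)) * c (Suc m) * (real n + 1 - real m) * cos ((real n + 1 - real m) * \<theta>)"
  "sinesum_deriv M \<theta> (Suc n) (Suc m) = sinesum_deriv M \<theta> (Suc (Suc n)) m
      + c (Suc n) * c m * (real n + 1 - real m) * cos ((real n + 1 - real m) * \<theta>)"
  "sinesum_deriv M \<theta> (Suc n) (Suc (Suc m)) = sinesum_deriv M \<theta> (Suc (Suc n)) (Suc m)
      + c (Suc n) * c (Suc m) * (real n - real m) * cos ((real n - real m) * \<theta>)"
  by (simp_all add: algebra_simps)

lemma trig_shift_base:
  "2 * cos \<theta> * sin ((real n + 1) * \<theta>) = sin ((real n + 2) * \<theta>) + sin (real n * \<theta>)"
  "2 * cos \<theta> * cos ((real n + 1) * \<theta>) = cos ((real n + 2) * \<theta>) + cos (real n * \<theta>)"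
  "2 * sin \<theta> * sin ((real n + 1) * \<theta>) = cos (real n * \<theta>) - cos ((real n + 2) * \<theta>)"
  "2 * sin \<theta> * cos ((real n + 1) * \<theta>) = sin ((real n + 2) * \<theta>) - sin (real n * \<theta>)"
  using trig_shift[where k="real n + 1"] by (simp_all add: algebra_simps)

lemma trig_shift_step:
  "2 * cos \<theta> * sin ((real n - real m) * \<theta>)
     = sin ((real n + 1 - real m) * \<theta>) + sin ((real n - 1 - real m) * \<theta>)"
  "2 * cos \<theta> * cos ((real n - real m) * \<theta>)
     = cos ((real n + 1 - real m) * \<theta>) + cos ((real n - 1 - real m) * \<theta>)"
  "2 * sin \<theta> * sin ((real n - real m) * \<theta>)
     = cos ((real n - 1 - real m) * \<theta>) - cos ((real n + 1 - real m) * \<theta>)"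
  "2 * sin \<theta> * cos ((real n - real m) * \<theta>)
     = sin ((real n + 1 - real m) * \<theta>) - sin ((real n - 1 - real m) * \<theta>)"
  using trig_shift[where k="real n - real m"] by (simp_all add: algebra_simps)

lemma base_simps:
  "c 0 = 1" "c (Suc 0) = real M" "(real n - 0) * \<theta> = real n * \<theta>"
  "(real n + 1 - 0) * \<theta> = (real n + 1) * \<theta>"
  "(1 + real n + 1 - 0) * \<theta> = (real n + 2) * \<theta>"
  by simp_all

lemma index_shift:
  "(real (Suc n) - real m) * \<theta> = (real n + 1 - real m) * \<theta>"
  "(real n - real (Suc m)) * \<theta> = (real n - 1 - real m) * \<theta>"
  by (simp_all add: algebra_simps)

text \<open>The next four identities are entrywise forms of the differential equations of the weight.
  Each relates an entry to its neighbours on the two adjacent antidiagonals. Along the recursion both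
  sides change by the same multiples of the two frequencies \<open>n + 1 - m\<close> and \<open>n - 1 - m\<close>, because of
  \<open>(k + 1) (M choose (k + 1)) = (M - k) (M choose k)\<close>.

  The first one says that the coefficient \<open>B = B\<^sub>0 + u B\<^sub>1\<close> of the first-order operator satisfies
  \<open>B W + W B\<^sup>t = 0\<close>. So the part of the operator that is multiplied by \<open>\<alpha>\<close> does not contribute to
  the symmetric combination in \<open>weight_pearson_equation\<close>.\<close>
lemma sinesum_skew:
  "(real n + real m + 2) * sinesum M \<theta> (Suc (Suc n)) (Suc m) - (2 * real M - real n - real m) * sinesum M \<theta> (Suc n) m
     - 2 * (real M - 1 - real n - real m) * cos \<theta> * sinesum M \<theta> (Suc n) (Suc m)
   = ((real M - real n) * c m * c n - (real m + 1) * c (Suc m) * c (Suc n)) * sin ((real n - real m) * \<theta>)"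
proof (induction m arbitrary: n)
  case 0
  have "((real n + 2) * c (Suc (Suc n))) * sin ((real n + 2) * \<theta>) - (real M - 1 - real n) * c (Suc n) * (2 * cos \<theta> * sin ((real n + 1) * \<theta>))
      = ((real M - real n) * c n - real M * c (Suc n)) * sin (real n * \<theta>)"
    unfolding trig_shift_base(1) choose_rec(2) choose_rec(1)[symmetric] by (simp add: algebra_simps)
  then show ?case
    unfolding sinesum_steps(2) sinesum_deriv_steps(2) sinesum.simps(1) sinesum_deriv.simps(1)
    unfolding of_nat_Suc of_nat_0 base_simps by (simp add: algebra_simps del: binomial_Suc_Suc)
next
  case (Suc m)
  have "((real n + 2) * c (Suc (Suc n))) * c (Suc m) * sin ((real n + 1 - real m) * \<theta>) - ((real M - real m) * c m) * c (Suc n) * sin ((real n + 1 - real m) * \<theta>) - (real M - 2 - real n - real m) * c (Suc n) * c (Suc m) * (2 * cos \<theta> * sin ((real n - real m) * \<theta>))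
      = (((real M - real n) * c n) * c (Suc m) - ((real m + 2) * c (Suc (Suc m))) * c (Suc n)) * sin ((real n - 1 - real m) * \<theta>)"
    unfolding trig_shift_step(1) choose_rec(2) choose_rec(1)[symmetric] by (simp add: algebra_simps)
  then show ?case
    using Suc[of "Suc n"]
    unfolding sinesum_steps sinesum_deriv_steps index_shift unfolding of_nat_Suc
    by (simp add: algebra_simps del: binomial_Suc_Suc sinesum.simps sinesum_deriv.simps)
qed

text \<open>This is \<open>2 (u (1 - u) W)' = (C - u U) W + W (C - u U)\<^sup>t\<close>, the matrix form of Pearson's
  equation.\<close>
lemma sinesum_pearson:
  "(real n + real m + 2) * sinesum M \<theta> (Suc (Suc n)) (Suc m) + (2 * real M - real n - real m) * sinesum M \<theta> (Suc n) m
     + ((real M - real n) * c m * c n + (real m + 1) * c (Suc m) * c (Suc n)) * sin ((real n - real m) * \<theta>)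
   = 2 * real M * cos \<theta> * sinesum M \<theta> (Suc n) (Suc m) - 2 * sin \<theta> * sinesum_deriv M \<theta> (Suc n) (Suc m)"
proof (induction m arbitrary: n)
  case 0
  have "((real n + 2) * c (Suc (Suc n))) * sin ((real n + 2) * \<theta>) + ((real M - real n) * c n + real M * c (Suc n)) * sin (real n * \<theta>)
      = c (Suc n) * (real M * (2 * cos \<theta> * sin ((real n + 1) * \<theta>)) - (real n + 1) * (2 * sin \<theta> * cos ((real n + 1) * \<theta>)))"
    unfolding trig_shift_base(1,4) choose_rec(2) choose_rec(1)[symmetric] by (simp add: algebra_simps)
  then show ?case
    unfolding sinesum_steps(2) sinesum_deriv_steps(2) sinesum.simps(1) sinesum_deriv.simps(1)
    unfolding of_nat_Suc of_nat_0 base_simps by (simp add: algebra_simps del: binomial_Suc_Suc)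
next
  case (Suc m)
  have "((real n + 2) * c (Suc (Suc n))) * c (Suc m) * sin ((real n + 1 - real m) * \<theta>) + ((real M - real m) * c m) * c (Suc n) * sin ((real n + 1 - real m) * \<theta>) + (((real M - real n) * c n) * c (Suc m) + ((real m + 2) * c (Suc (Suc m))) * c (Suc n)) * sin ((real n - 1 - real m) * \<theta>)
      = c (Suc n) * c (Suc m) * (real M * (2 * cos \<theta> * sin ((real n - real m) * \<theta>)) - (real n - real m) * (2 * sin \<theta> * cos ((real n - real m) * \<theta>)))"
    unfolding trig_shift_step(1,4) choose_rec(2) choose_rec(1)[symmetric] by (simp add: algebra_simps)
  then show ?case
    using Suc[of "Suc n"]
    unfolding sinesum_steps sinesum_deriv_steps index_shift unfolding of_nat_Suc
    by (simp add: algebra_simps del: binomial_Suc_Suc sinesum.simps sinesum_deriv.simps)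
qed

text \<open>This gives the derivative of the skew part of \<open>(C - u U) W\<close>; a factor \<open>n - m\<close>, common to both
  sides there, is divided out.\<close>
lemma sinesum_deriv_second_order:
  "sinesum_deriv M \<theta> (Suc n) m - sinesum_deriv M \<theta> (Suc (Suc n)) (Suc m) + ((real m + 1) * c (Suc m) * c (Suc n) - (real M - real n) * c m * c n) * cos ((real n - real m) * \<theta>)
   = 2 * (real M - 1 - real n - real m) * sin \<theta> * sinesum M \<theta> (Suc n) (Suc m)"
proof (induction m arbitrary: n)
  case 0
  have "(real M * c (Suc n) - (real M - real n) * c n) * cos (real n * \<theta>) - ((real n + 2) * c (Suc (Suc n))) * cos ((real n + 2) * \<theta>)
      = (real M - 1 - real n) * c (Suc n) * (2 * sin \<theta> * sin ((real n + 1) * \<theta>))"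
    unfolding trig_shift_base(3) choose_rec(2) choose_rec(1)[symmetric] by (simp add: algebra_simps)
  then show ?case
    unfolding sinesum_steps(2) sinesum_deriv_steps(2) sinesum.simps(1) sinesum_deriv.simps(1)
    unfolding of_nat_Suc of_nat_0 base_simps by (simp add: algebra_simps del: binomial_Suc_Suc)
next
  case (Suc m)
  have "((real M - real m) * c m) * c (Suc n) * cos ((real n + 1 - real m) * \<theta>) - ((real n + 2) * c (Suc (Suc n))) * c (Suc m) * cos ((real n + 1 - real m) * \<theta>) + (((real m + 2) * c (Suc (Suc m))) * c (Suc n) - ((real M - real n) * c n) * c (Suc m)) * cos ((real n - 1 - real m) * \<theta>)
      = (real M - 2 - real n - real m) * c (Suc n) * c (Suc m) * (2 * sin \<theta> * sin ((real n - real m) * \<theta>))"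
    unfolding trig_shift_step(3) choose_rec(2) choose_rec(1)[symmetric] by (simp add: algebra_simps)
  then show ?case
    using Suc[of "Suc n"]
    unfolding sinesum_steps sinesum_deriv_steps index_shift unfolding of_nat_Suc
    by (simp add: algebra_simps del: binomial_Suc_Suc sinesum.simps sinesum_deriv.simps)
qed

text \<open>This gives \<open>(B W)' = A\<^sub>0 W - W A\<^sub>0\<^sup>t\<close>, again without the common factor \<open>n - m\<close>.\<close>
lemma sinesum_deriv_first_order:
  "sinesum_deriv M \<theta> (Suc (Suc n)) (Suc m) + sinesum_deriv M \<theta> (Suc n) m - ((real m + 1) * c (Suc m) * c (Suc n) + (real M - real n) * c m * c n) * cos ((real n - real m) * \<theta>)
   = - 2 * real M * sin \<theta> * sinesum M \<theta> (Suc n) (Suc m) - 2 * cos \<theta> * sinesum_deriv M \<theta> (Suc n) (Suc m)"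
proof (induction m arbitrary: n)
  case 0
  have "((real n + 2) * c (Suc (Suc n))) * cos ((real n + 2) * \<theta>) - (real M * c (Suc n) + (real M - real n) * c n) * cos (real n * \<theta>)
      = - c (Suc n) * (real M * (2 * sin \<theta> * sin ((real n + 1) * \<theta>)) + (real n + 1) * (2 * cos \<theta> * cos ((real n + 1) * \<theta>)))"
    unfolding trig_shift_base(2,3) choose_rec(2) choose_rec(1)[symmetric] by (simp add: algebra_simps)
  then show ?case
    unfolding sinesum_steps(2) sinesum_deriv_steps(2) sinesum.simps(1) sinesum_deriv.simps(1)
    unfolding of_nat_Suc of_nat_0 base_simps by (simp add: algebra_simps del: binomial_Suc_Suc)
next
  case (Suc m)
  have "((real n + 2) * c (Suc (Suc n))) * c (Suc m) * cos ((real n + 1 - real m) * \<theta>) + ((real M - real m) * c m) * c (Suc n) * cos ((real n + 1 - real m) * \<theta>) - (((real m + 2) * c (Suc (Suc m))) * c (Suc n) + ((real M - real n) * c n) * c (Suc m)) * cos ((real n - 1 - real m) * \<theta>)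
      = - (c (Suc n) * c (Suc m) * (real M * (2 * sin \<theta> * sin ((real n - real m) * \<theta>)) + (real n - real m) * (2 * cos \<theta> * cos ((real n - real m) * \<theta>))))"
    unfolding trig_shift_step(2,3) choose_rec(2) choose_rec(1)[symmetric] by (simp add: algebra_simps)
  then show ?case
    using Suc[of "Suc n"]
    unfolding sinesum_steps sinesum_deriv_steps index_shift unfolding of_nat_Suc
    by (simp add: algebra_simps del: binomial_Suc_Suc sinesum.simps sinesum_deriv.simps)
qed

end

section \<open>The Gram factorization of the weight\<close>
text \<open>For \<open>z = cis \<theta>\<close> the vectors with index \<open>j\<close> are, up to the factors \<open>N choose n\<close>, the vectors
  \<open>d\<^sub>j\<close> with \<open>W(cos \<theta>) = sin \<theta> * (\<Sum>j\<le>N. d\<^sub>j * d\<^sub>j\<^sup>*)\<close>. Their generating function is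
  \<open>(1 + a z)\<^sup>j (1 + a / z)\<^sup>N\<^sup>-\<^sup>j\<close>, written with \<open>cnj z\<close> for \<open>1 / z\<close>.\<close>
definition gram_vec :: "nat \<Rightarrow> complex \<Rightarrow> nat \<Rightarrow> nat \<Rightarrow> complex" where
  "gram_vec N z j n = Polynomial.coeff ([:1, z:] ^ j * [:1, cnj z:] ^ (N - j)) n"

text \<open>The predecessor with value \<open>0\<close> at \<open>n = 0\<close>: the coefficients of \<open>a\<close> times the generating
  function.\<close>
definition gram_vec_prev :: "nat \<Rightarrow> complex \<Rightarrow> nat \<Rightarrow> nat \<Rightarrow> complex" where
  "gram_vec_prev N z j n = (case n of 0 \<Rightarrow> 0 | Suc k \<Rightarrow> gram_vec N z j k)"

lemma gram_vec_prev_simps [simp]: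
  "gram_vec_prev N z j 0 = 0" "gram_vec_prev N z j (Suc n) = gram_vec N z j n"
  by (simp_all add: gram_vec_prev_def)

lemma gram_vec_Suc:
  assumes "j \<le> N"
  shows "gram_vec (Suc N) z (Suc j) n
      = gram_vec N z j n + z * gram_vec_prev N z j n"
    and "gram_vec (Suc N) z j n
      = gram_vec N z j n + cnj z * gram_vec_prev N z j n"
proof -
  have 1: "[:1, z:] ^ Suc j * [:1, cnj z:] ^ (Suc N - Suc j)
      = [:1, z:] * ([:1, z:] ^ j * [:1, cnj z:] ^ (N - j))"
    by (simp only: power_Suc diff_Suc_Suc mult.assoc)
  have 2: "[:1, z:] ^ j * [:1, cnj z:] ^ (Suc N - j)
      = [:1, cnj z:] * ([:1, z:] ^ j * [:1, cnj z:] ^ (N - j))"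
    using assms by (simp only: Suc_diff_le power_Suc mult_ac)
  have lin: "Polynomial.coeff ([:1, w:] * p) n = Polynomial.coeff p n + w * (case n of 0 \<Rightarrow> 0 | Suc k \<Rightarrow> Polynomial.coeff p k)"
    for w :: complex and p by (cases n) auto
  show "gram_vec (Suc N) z (Suc j) n
      = gram_vec N z j n + z * gram_vec_prev N z j n"
    unfolding gram_vec_def gram_vec_prev_def 1 lin ..
  show "gram_vec (Suc N) z j n
      = gram_vec N z j n + cnj z * gram_vec_prev N z j n"
    unfolding gram_vec_def gram_vec_prev_def 2 lin ..
qed

lemma gram_vec_beyond: "j \<le> N \<Longrightarrow> N < n \<Longrightarrow> gram_vec N z j n = 0"
proof -
  assume a: "j \<le> N" "N < n"
  have d: "degree ([:1, w:] ^ k) \<le> k" for w :: complex and k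
    using degree_power_le[of "[:1, w:]" k] by (auto intro: order_trans split: if_splits)
  have "degree ([:1, z:] ^ j * [:1, cnj z:] ^ (N - j)) \<le> j + (N - j)"
    by (meson add_mono d degree_mult_le le_trans)
  then show ?thesis using a by (simp add: gram_vec_def coeff_eq_0)
qed

lemma gram_vec_extreme:
  "gram_vec M z M n = of_nat (M choose n) * z ^ n"
  "gram_vec M z 0 n = of_nat (M choose n) * cnj z ^ n"
proof -
  have *: "gram_vec M z M n = of_nat (M choose n) * z ^ n" for z
  proof (cases "n \<le> M")
    case True
    then show ?thesis using coeff_linear_poly_power[of n M 1 z] by (simp add: gram_vec_def)
  next
    case False
    then show ?thesis by (simp add: gram_vec_beyond)
  qed
  show "gram_vec M z M n = of_nat (M choose n) * z ^ n" by (rule *)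
  have "gram_vec M z 0 n = gram_vec M (cnj z) M n" by (simp add: gram_vec_def)
  then show "gram_vec M z 0 n = of_nat (M choose n) * cnj z ^ n" by (simp add: *)
qed

text \<open>With \<open>X = (1 + a z) (1 + b / z)\<close> and \<open>Y = (1 + a / z) (1 + b z)\<close> the generating function of
  the Gram matrix is \<open>\<Sum>j\<le>N. X\<^sup>j Y\<^sup>N\<^sup>-\<^sup>j\<close>, and \<open>X - Y = (z - 1 / z) (a - b)\<close>. So the geometric sum
  telescopes to \<open>X\<^sup>N\<^sup>+\<^sup>1 - Y\<^sup>N\<^sup>+\<^sup>1\<close> after multiplication with \<open>X - Y\<close>. The lemma is this
  computation for the coefficient of \<open>a\<^sup>n b\<^sup>m\<close>.\<close>
lemma gram_recursion:
  "(z - cnj z) * (\<Sum>j\<le>N. gram_vec_prev N z j n * cnj (gram_vec N z j m)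
          - gram_vec N z j n * cnj (gram_vec_prev N z j m))
     = of_nat (Suc N choose n) * of_nat (Suc N choose m) * (z ^ n * cnj z ^ m - cnj z ^ n * z ^ m)"
proof -
  define E where "E j = gram_vec (Suc N) z j n * cnj (gram_vec (Suc N) z j m)" for j
  have "(z - cnj z) * (gram_vec_prev N z j n * cnj (gram_vec N z j m)
        - gram_vec N z j n * cnj (gram_vec_prev N z j m)) = E (Suc j) - E j"
    if "j \<le> N" for j
  proof -
    have E1: "E (Suc j) = (gram_vec N z j n + z * gram_vec_prev N z j n)
        * (cnj (gram_vec N z j m) + cnj z * cnj (gram_vec_prev N z j m))"
      unfolding E_def gram_vec_Suc(1)[OF that] by simp
    have E2: "E j = (gram_vec N z j n + cnj z * gram_vec_prev N z j n)
        * (cnj (gram_vec N z j m) + z * cnj (gram_vec_prev N z j m))"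
      unfolding E_def gram_vec_Suc(2)[OF that] by simp
    show ?thesis unfolding E1 E2 by (simp add: algebra_simps)
  qed
  then have "(z - cnj z) * (\<Sum>j\<le>N. gram_vec_prev N z j n * cnj (gram_vec N z j m)
          - gram_vec N z j n * cnj (gram_vec_prev N z j m))
      = (\<Sum>j\<le>N. E (Suc j) - E j)"
    unfolding sum_distrib_left by (intro sum.cong) auto
  also have "\<dots> = E (Suc N) - E 0" 
    using sum_lessThan_telescope[of E "Suc N"] by (simp add: lessThan_Suc_atMost)
  also have "\<dots> = of_nat (Suc N choose n) * of_nat (Suc N choose m)
      * (z ^ n * cnj z ^ m - cnj z ^ n * z ^ m)"
    unfolding E_def gram_vec_extreme by (simp add: algebra_simps del: binomial_Suc_Suc)
  finally show ?thesis .
qed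

lemma gram_recursion_cis:
  defines "D \<equiv> \<lambda>N \<theta>. gram_vec N (cis \<theta>)" and "D' \<equiv> \<lambda>N \<theta>. gram_vec_prev N (cis \<theta>)"
  shows "of_real (sin \<theta>) * (\<Sum>j\<le>N. D' N \<theta> j n * cnj (D N \<theta> j m))
       = of_real (sin \<theta>) * (\<Sum>j\<le>N. D N \<theta> j n * cnj (D' N \<theta> j m))
       + of_real (real (Suc N choose n) * real (Suc N choose m) * sin ((real n - real m) * \<theta>))"
proof -
  have 1: "cis \<theta> - cnj (cis \<theta>) = 2 * \<i> * of_real (sin \<theta>)"
    by (simp add: complex_eq_iff)
  have 2: "cis \<theta> ^ n * cnj (cis \<theta>) ^ m - cnj (cis \<theta>) ^ n * cis \<theta> ^ m
      = 2 * \<i> * of_real (sin ((real n - real m) * \<theta>))"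
    by (simp add: cis_cnj Complex.DeMoivre cis_mult complex_eq_iff algebra_simps sin_diff cos_diff)
  have "(2 * \<i>) * (of_real (sin \<theta>) * (\<Sum>j\<le>N. D' N \<theta> j n * cnj (D N \<theta> j m) - D N \<theta> j n * cnj (D' N \<theta> j m)))
      = (2 * \<i>) * (of_real (real (Suc N choose n) * real (Suc N choose m) * sin ((real n - real m) * \<theta>)))"
    using gram_recursion[of "cis \<theta>" N n m] unfolding 1 2 D_def D'_def
    by (simp add: mult_ac del: binomial_Suc_Suc)
  then show ?thesis unfolding mult_cancel_left
    by (simp add: sum_subtractf algebra_simps del: binomial_Suc_Suc)
qed

text \<open>The recursion of the Gram matrix is the one that defines \<open>sinesum\<close>.\<close>
lemma sinesum_gram_vec_prev:
  "of_real (sinesum (Suc N) \<theta> n m)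
     = of_real (sin \<theta>) * (\<Sum>j\<le>N. gram_vec_prev N (cis \<theta>) j n * cnj (gram_vec_prev N (cis \<theta>) j m))"
proof (induction m arbitrary: n)
  case 0
  show ?case by simp
next
  case (Suc m)
  show ?case
    unfolding sinesum.simps of_real_add Suc gram_vec_prev_simps gram_recursion_cis ..
qed

lemma sinesum_gram:
  "of_real (sinesum (Suc N) \<theta> (Suc n) (Suc m))
     = of_real (sin \<theta>) * (\<Sum>j\<le>N. gram_vec N (cis \<theta>) j n * cnj (gram_vec N (cis \<theta>) j m))"
  by (simp add: sinesum_gram_vec_prev del: sinesum.simps)

text \<open>The Gram matrix is Hermitian, and its entries are real here. The recursion by itself treats the
  two indices differently.\<close>
lemma sinesum_sym: "sinesum (Suc N) \<theta> n m = sinesum (Suc N) \<theta> m n"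
proof -
  have "complex_of_real (sinesum (Suc N) \<theta> n m) = cnj (of_real (sinesum (Suc N) \<theta> m n))"
    unfolding sinesum_gram_vec_prev by (simp add: mult_ac)
  then show ?thesis by simp
qed

lemma sinesum_beyond: "sinesum (Suc N) \<theta> (Suc (Suc N)) m = 0"
  unfolding of_real_eq_0_iff[where 'a = complex, symmetric] sinesum_gram_vec_prev
  by (simp add: gram_vec_beyond)

text \<open>The products \<open>(1 + a z)\<^sup>j (1 + a / z)\<^sup>N\<^sup>-\<^sup>j\<close> span the polynomials in \<open>a\<close> of degree at most \<open>N\<close>,
  because \<open>1\<close> and \<open>a\<close> are linear combinations of \<open>1 + a z\<close> and \<open>1 + a / z\<close>. This is
  what makes the weight definite and not just semidefinite.\<close>
lemma gram_vec_separating: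
  assumes z: "z \<noteq> cnj z"
    and "\<And>j. j \<le> N \<Longrightarrow> (\<Sum>n\<le>N. v n * gram_vec N z j n) = 0" and "n \<le> N"
  shows "v n = 0"
  using assms(2,3)
proof (induction N arbitrary: v n)
  case 0
  then show ?case by (simp add: gram_vec_def)
next
  case (Suc N)
  have "(\<Sum>n\<le>N. v n * gram_vec N z j n) = 0 \<and> (\<Sum>n\<le>N. v (Suc n) * gram_vec N z j n) = 0"
    if j: "j \<le> N" for j
  proof -
    have *: "(\<Sum>n\<le>Suc N. v n * (gram_vec N z j n
          + w * gram_vec_prev N z j n))
        = (\<Sum>n\<le>N. v n * gram_vec N z j n) + w * (\<Sum>n\<le>N. v (Suc n) * gram_vec N z j n)"
      for w
    proof -
      have "(\<Sum>n\<le>Suc N. v n * gram_vec N z j n) = (\<Sum>n\<le>N. v n * gram_vec N z j n)"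
        using gram_vec_beyond[OF j] by simp
      moreover have "(\<Sum>n\<le>Suc N. v n * gram_vec_prev N z j n)
          = (\<Sum>n\<le>N. v (Suc n) * gram_vec N z j n)"
        by (subst sum.atMost_Suc_shift) simp
      moreover have "(\<Sum>n\<le>Suc N. v n * (gram_vec N z j n
          + w * gram_vec_prev N z j n))
        = (\<Sum>n\<le>Suc N. v n * gram_vec N z j n)
         + w * (\<Sum>n\<le>Suc N. v n * gram_vec_prev N z j n)"
        by (simp only: sum_distrib_left sum.distrib[symmetric] algebra_simps)
      ultimately show ?thesis by simp
    qed
    have a: "(\<Sum>n\<le>N. v n * gram_vec N z j n) + z * (\<Sum>n\<le>N. v (Suc n) * gram_vec N z j n) = 0"
      using Suc.prems(1)[of "Suc j"] j unfolding gram_vec_Suc(1)[OF j] * by simp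
    have b: "(\<Sum>n\<le>N. v n * gram_vec N z j n) + cnj z * (\<Sum>n\<le>N. v (Suc n) * gram_vec N z j n) = 0"
      using Suc.prems(1)[of j] j unfolding gram_vec_Suc(2)[OF j] * by simp
    have "(z - cnj z) * (\<Sum>n\<le>N. v (Suc n) * gram_vec N z j n)
      = ((\<Sum>n\<le>N. v n * gram_vec N z j n) + z * (\<Sum>n\<le>N. v (Suc n) * gram_vec N z j n))
        - ((\<Sum>n\<le>N. v n * gram_vec N z j n) + cnj z * (\<Sum>n\<le>N. v (Suc n) * gram_vec N z j n))"
      by (simp only: left_diff_distrib add_diff_add diff_self add_0_left)
    also have "\<dots> = 0" unfolding a b by simp
    finally have "(z - cnj z) * (\<Sum>n\<le>N. v (Suc n) * gram_vec N z j n) = 0" .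
    then have "(\<Sum>n\<le>N. v (Suc n) * gram_vec N z j n) = 0" using z by simp
    then show ?thesis using a by simp
  qed
  then have "v 0 = 0" and "v (Suc k) = 0" if "k \<le> N" for k
    using Suc.IH[of v] Suc.IH[of "\<lambda>n. v (Suc n)"] that by blast+
  then show ?case using Suc.prems(2) by (cases n) auto
qed

section \<open>The weight as a sine sum\<close>
lemma sinesum_closed:
  "sinesum M \<theta> (Suc n) m = (\<Sum>t<m. real (M choose t) * real (M choose (n + m - t))
     * sin ((real n + real m - 2 * real t) * \<theta>))"
proof (induction m arbitrary: n)
  case 0
  show ?case by simp
next
  case (Suc m)
  show ?case
    using Suc[of "Suc n"] by (simp add: algebra_simps del: binomial_Suc_Suc)
qed

lemma sin_chebU: "sin \<theta> * chebU r (cos \<theta>) = sin ((real r + 1) * \<theta>)"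
proof (induction r "cos \<theta>" rule: chebU.induct)
  case (3 r)
  have "sin \<theta> * chebU (Suc (Suc r)) (cos \<theta>)
      = 2 * cos \<theta> * (sin \<theta> * chebU (Suc r) (cos \<theta>)) - sin \<theta> * chebU r (cos \<theta>)"
    by (simp add: algebra_simps)
  also have "\<dots> = 2 * cos \<theta> * sin ((real r + 2) * \<theta>) - sin ((real r + 1) * \<theta>)"
    unfolding 3 by (simp add: algebra_simps)
  also have "\<dots> = sin ((real (Suc (Suc r)) + 1) * \<theta>)"
    using trig_shift(1)[of \<theta> "real r + 2"] by (simp add: algebra_simps)
  finally show ?case .
qed (use trig_shift(1)[of \<theta> 1] in \<open>simp_all add: mult_ac\<close>)

lemma pochhammer_minus_choose:
  "(-1) ^ k * pochhammer (- real a) k = fact k * real (a choose k)"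
  using gbinomial_pochhammer[of "real a" k] by (simp add: binomial_gbinomial field_simps)

lemma pochhammer_fact_quotient: "pochhammer (real a + 1) k = fact (a + k) / fact a"
proof (induction k)
  case (Suc k)
  have "fact (a + Suc k) = (real a + 1 + real k) * fact (a + k)"
    by (simp add: algebra_simps)
  then show ?case using Suc by (simp add: pochhammer_Suc)
qed simp

lemma choose_fact_real: "k \<le> n \<Longrightarrow> real (n choose k) = fact n / (fact k * fact (n - k))"
  by (simp add: binomial_fact)

lemma choose_shift:
  assumes "n \<le> N"
  shows "fact (Suc N) * fact r * real (N - n choose r)
       = real (Suc N choose (n + 1 + r)) * fact (n + 1 + r) * fact (N - n)"
proof (cases "r \<le> N - n")
  case True
  then show ?thesis using assms
    by (simp add: choose_fact_real field_simps del: fact_Suc of_nat_Suc binomial_Suc_Suc)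
next
  case False
  then have "N - n choose r = 0" "Suc N choose (n + 1 + r) = 0"
    using assms by (auto simp del: binomial_Suc_Suc)
  then show ?thesis by (simp only: of_nat_0 mult_zero_left mult_zero_right)
qed

text \<open>Cancelling the factorials shows that \<open>\<alpha>\<^sub>t(m, n)\<close> depends only on \<open>t\<close> and \<open>n + m\<close>, up to the
  normalization. The Pochhammer symbol \<open>(n - N)\<^sub>m\<^sub>-\<^sub>t\<close> vanishes for \<open>m - t > N - n\<close>, as
  does the second binomial coefficient.\<close>
lemma weight_coeff_binomial:
  assumes "t \<le> m" "m \<le> n" "n \<le> N"
  shows "weight_coeff N t m n = real (Suc N choose t) * real (Suc N choose (n + m + 1 - t))
     / (real (N choose n) * real (N choose m))"
proof -
  obtain r where r: "m = t + r" using assms(1) le_Suc_ex by blast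
  have 1: "(-1) ^ r * pochhammer (real n - 2 * ell N) r = fact r * real (N - n choose r)"
    using pochhammer_minus_choose[of r "N - n"] assms by (simp add: of_nat_diff)
  have 2: "pochhammer (real n + 2) r = fact (n + 1 + r) / fact (n + 1)"
    using pochhammer_fact_quotient[of "n + 1" r] by (simp add: add_ac del: fact_Suc)
  have 3: "pochhammer (2 * ell N + 2 - real t) t / fact t = real (Suc N choose t)"
  proof -
    have "2 * ell N + 2 - real t = real (Suc N - t) + 1" "Suc N - t + t = Suc N"
      using assms by (auto simp: of_nat_diff)
    then have "pochhammer (2 * ell N + 2 - real t) t = fact (Suc N) / fact (Suc N - t)"
      using pochhammer_fact_quotient[of "Suc N - t" t] by (simp only:)
    then show ?thesis using assms
      by (simp add: choose_fact_real field_simps del: fact_Suc of_nat_Suc binomial_Suc_Suc)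
  qed
  have N1: "2 * ell N + 1 = fact (Suc N) / fact N" by simp
  have n1: "real n + 1 = fact (n + 1) / fact n" by simp
  have "weight_coeff N t m n = (fact (Suc N) / fact N) / (fact (n + 1) / fact n)
     * (fact (N - m) * fact m / fact N) * (fact r * real (N - n choose r) / (fact (n + 1 + r) / fact (n + 1)))
     * real (Suc N choose t)"
    unfolding weight_coeff_def 3 N1 n1 using r 1 2 by (simp add: mult.assoc)
  also have "\<dots> = (fact (Suc N) * fact r * real (N - n choose r)) / fact (n + 1 + r)
      * (fact n / fact N) * (fact (N - m) * fact m / fact N) * real (Suc N choose t)"
    by (simp add: field_simps del: fact_Suc of_nat_Suc binomial_Suc_Suc)
  also have "\<dots> = real (Suc N choose (n + 1 + r)) * real (Suc N choose t)
      * (fact n * fact (N - n) / fact N) * (fact (N - m) * fact m / fact N)"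
    unfolding choose_shift[OF assms(3)]
    by (simp add: field_simps del: fact_Suc of_nat_Suc binomial_Suc_Suc)
  also have "\<dots> = real (Suc N choose t) * real (Suc N choose (n + m + 1 - t))
     / (real (N choose n) * real (N choose m))"
    using assms r by (simp add: choose_fact_real field_simps del: fact_Suc of_nat_Suc binomial_Suc_Suc)
  finally show ?thesis .
qed

definition real_weight :: "nat \<Rightarrow> nat \<Rightarrow> nat \<Rightarrow> real \<Rightarrow> real" where
  "real_weight N n m x = sinesum (Suc N) (arccos x) (Suc n) (Suc m) / (real (N choose n) * real (N choose m))"

lemma real_weight_sym: "real_weight N n m x = real_weight N m n x"
  by (simp add: real_weight_def mult.commute sinesum_sym[of N _ "Suc n" "Suc m"] del: sinesum.simps)

lemma weight_entry_eq:
  assumes "m \<le> n" "n \<le> N" "-1 \<le> x" "x \<le> 1"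
  shows "weight_entry N x n m = real_weight N n m x"
proof -
  define \<theta> where "\<theta> = arccos x"
  have x: "x = cos \<theta>" "sqrt (1 - x\<^sup>2) = sin \<theta>"
    using assms by (simp_all add: \<theta>_def sin_arccos)
  have "weight_entry N x n m
      = (\<Sum>t\<le>m. weight_coeff N t m n * (sin \<theta> * chebU (n + m - 2 * t) (cos \<theta>)))"
    unfolding weight_entry_def x(2) unfolding x(1) by (simp add: sum_distrib_left mult_ac)
  also have "\<dots> = (\<Sum>t\<le>m. (real (Suc N choose t) * real (Suc N choose (n + Suc m - t))
     * sin ((real n + real (Suc m) - 2 * real t) * \<theta>)) / (real (N choose n) * real (N choose m)))"
  proof (intro sum.cong refl)
    fix t assume "t \<in> {..m}"
    then have t: "t \<le> m" by simp
    have "real (n + m - 2 * t) + 1 = real n + real (Suc m) - 2 * real t"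
      using t assms by (simp add: of_nat_diff)
    moreover have "n + m + 1 - t = n + Suc m - t" by simp
    ultimately show "weight_coeff N t m n * (sin \<theta> * chebU (n + m - 2 * t) (cos \<theta>))
      = (real (Suc N choose t) * real (Suc N choose (n + Suc m - t))
     * sin ((real n + real (Suc m) - 2 * real t) * \<theta>)) / (real (N choose n) * real (N choose m))"
      unfolding sin_chebU weight_coeff_binomial[OF t assms(1,2)] by (simp only: times_divide_eq_left)
  qed
  also have "\<dots> = real_weight N n m x"
    unfolding real_weight_def sinesum_closed \<theta>_def by (simp add: sum_divide_distrib lessThan_Suc_atMost del: binomial_Suc_Suc of_nat_Suc)
  finally show ?thesis .
qed

lemma weight_eq_real_weight:
  assumes "n \<le> N" "m \<le> N" "-1 \<le> x" "x \<le> 1"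
  shows "weight N x $$ (n, m) = complex_of_real (real_weight N n m x)"
  using assms weight_entry_eq[of m n N x] weight_entry_eq[of n m N x] real_weight_sym[of N n m x]
  by (auto simp: weight_def cmat_def)

lemma real_weight_gram:
  defines "D \<equiv> \<lambda>N x j n. gram_vec N (cis (arccos x)) j n / of_nat (N choose n)"
  assumes "-1 \<le> x" "x \<le> 1"
  shows "complex_of_real (real_weight N n m x)
    = of_real (sqrt (1 - x\<^sup>2)) * (\<Sum>j\<le>N. D N x j n * cnj (D N x j m))"
  unfolding real_weight_def of_real_divide sinesum_gram D_def using assms
  by (simp add: sin_arccos sum_divide_distrib sum_distrib_left mult_ac)


section \<open>The differential equations of the weight\<close>
definition real_weight_dtheta :: "nat \<Rightarrow> nat \<Rightarrow> nat \<Rightarrow> real \<Rightarrow> real" where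
  "real_weight_dtheta N n m x = sinesum_deriv (Suc N) (arccos x) (Suc n) (Suc m) / (real (N choose n) * real (N choose m))"

text \<open>The entries of \<open>C\<^sub>\<alpha>\<close>, and the diagonal entries of \<open>U\<^sub>\<alpha>\<close> and \<open>V\<^sub>\<alpha>\<close>, in terms of \<open>g = \<alpha> / N\<close>.
  With this parameter no entry has a denominator that depends on \<open>N\<close>, and for \<open>N = 0\<close> it is \<open>0\<close>.\<close>
definition C_entry :: "nat \<Rightarrow> real \<Rightarrow> nat \<Rightarrow> nat \<Rightarrow> real" where
  "C_entry N g i j = (if j = i + 1 then - ((real N - real i) * (1 + g) / 2)
     else if j = i then (real N + 3 + g * (real N - 2 * real i)) / 2
     else if i = j + 1 then - (real i * (1 - g) / 2) else 0)"

definition U_entry :: "nat \<Rightarrow> real \<Rightarrow> nat \<Rightarrow> real" where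
  "U_entry N g i = real N + 3 + g * (real N - 2 * real i)"

definition V_entry :: "nat \<Rightarrow> real \<Rightarrow> nat \<Rightarrow> real" where
  "V_entry N g i = - (real i * (real N - real i)) - g * (real N + 2) * (real i - real N)"

text \<open>In the variable \<open>x = 1 - 2 u\<close> the first-order coefficient \<open>C\<^sub>\<alpha> - u U\<^sub>\<alpha>\<close> becomes
  \<open>-2 (C\<^sub>\<alpha> - u U\<^sub>\<alpha>) = (1 - x) U\<^sub>\<alpha> - 2 C\<^sub>\<alpha>\<close>.\<close>
definition drift :: "nat \<Rightarrow> real \<Rightarrow> nat \<Rightarrow> nat \<Rightarrow> real \<Rightarrow> real" where
  "drift N g i j x = (if i = j then (1 - x) * U_entry N g i else 0) - 2 * C_entry N g i j"

definition drift_weight :: "nat \<Rightarrow> real \<Rightarrow> nat \<Rightarrow> nat \<Rightarrow> real \<Rightarrow> real" where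
  "drift_weight N g n m x = (\<Sum>k\<le>N. drift N g n k x * real_weight N k m x)"

lemma sum_tridiagonal:
  fixes f :: "nat \<Rightarrow> real"
  assumes "n \<le> N" and "\<And>k. k \<le> N \<Longrightarrow> k \<noteq> n \<Longrightarrow> k \<noteq> Suc n \<Longrightarrow> n \<noteq> Suc k \<Longrightarrow> f k = 0"
  shows "(\<Sum>k\<le>N. f k) = f n + (if n < N then f (Suc n) else 0) + (case n of 0 \<Rightarrow> 0 | Suc k \<Rightarrow> f k)"
proof -
  have "(\<Sum>k\<le>N. f k) = (\<Sum>k\<in>{n} \<union> (if n < N then {Suc n} else {}) \<union> (case n of 0 \<Rightarrow> {} | Suc k \<Rightarrow> {k}). f k)"
    using assms by (intro sum.mono_neutral_right) (auto split: nat.splits if_splits)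
  also have "\<dots> = f n + (if n < N then f (Suc n) else 0) + (case n of 0 \<Rightarrow> 0 | Suc k \<Rightarrow> f k)"
    by (auto simp: add_ac split: nat.split)
  finally show ?thesis .
qed

lemma choose_quotients:
  assumes "n \<le> N"
  shows "n < N \<Longrightarrow> (real N - real n) / real (N choose Suc n) = (real n + 1) / real (N choose n)"
    and "n = Suc k \<Longrightarrow> real n / real (N choose k) = (real N - real k) / real (N choose n)"
  using assms choose_Suc_mult[of n N] choose_Suc_mult[of k N]
  by (auto simp: field_simps del: binomial_Suc_Suc)

text \<open>The formula has no boundary cases: at \<open>n = 0\<close> and \<open>n = N\<close> the neighbour that is missing in the
  matrix product is a vanishing sine sum.\<close>
lemma drift_weight_explicit:
  assumes "n \<le> N" "m \<le> N"
  defines "S \<equiv> \<lambda>N x. sinesum (Suc N) (arccos x)"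
  shows "drift_weight N g n m x = ((real n + 1) * (1 + g) * S N x (Suc (Suc n)) (Suc m)
      + (real (Suc N) - real n) * (1 - g) * S N x n (Suc m)
      - x * U_entry N g n * S N x (Suc n) (Suc m)) / (real (N choose n) * real (N choose m))"
proof -
  define \<kappa> where "\<kappa> = (\<lambda>i. real (N choose i))"
  have real_weight: "real_weight N k l x = S N x (Suc k) (Suc l) / (\<kappa> k * \<kappa> l)" for k l
    by (simp add: real_weight_def S_def \<kappa>_def del: sinesum.simps)
  have "drift_weight N g n m x = drift N g n n x * real_weight N n m x
     + (if n < N then drift N g n (Suc n) x * real_weight N (Suc n) m x else 0)
     + (case n of 0 \<Rightarrow> 0 | Suc k \<Rightarrow> drift N g n k x * real_weight N k m x)"
    unfolding drift_weight_def using assms(1) by (intro sum_tridiagonal) (auto simp: drift_def C_entry_def)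
  moreover have "drift N g n n x * real_weight N n m x = - (x * U_entry N g n * S N x (Suc n) (Suc m)) / (\<kappa> n * \<kappa> m)"
    by (simp add: real_weight drift_def C_entry_def U_entry_def algebra_simps add_divide_distrib diff_divide_distrib)
  moreover have "(if n < N then drift N g n (Suc n) x * real_weight N (Suc n) m x else 0)
      = (real n + 1) * (1 + g) * S N x (Suc (Suc n)) (Suc m) / (\<kappa> n * \<kappa> m)"
  proof (cases "n < N")
    case True
    have "drift N g n (Suc n) x * real_weight N (Suc n) m x
        = ((real N - real n) / \<kappa> (Suc n)) * ((1 + g) * S N x (Suc (Suc n)) (Suc m) / \<kappa> m)"
      by (simp add: real_weight drift_def C_entry_def)
    also have "(real N - real n) / \<kappa> (Suc n) = (real n + 1) / \<kappa> n"
      unfolding \<kappa>_def by (rule choose_quotients(1)[OF assms(1) True])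
    finally show ?thesis using True by simp
  next
    case False
    then have "S N x (Suc (Suc n)) (Suc m) = 0"
      using assms(1) sinesum_beyond[of N "arccos x" "Suc m"] by (simp add: S_def del: sinesum.simps)
    then show ?thesis using False by simp
  qed
  moreover have "(case n of 0 \<Rightarrow> 0 | Suc k \<Rightarrow> drift N g n k x * real_weight N k m x)
      = (real (Suc N) - real n) * (1 - g) * S N x n (Suc m) / (\<kappa> n * \<kappa> m)"
  proof (cases n)
    case 0
    then have "S N x n (Suc m) = 0" using sinesum_sym[of N "arccos x" 0 "Suc m"]
      by (simp add: S_def del: sinesum.simps(2))
    then show ?thesis using 0 by simp
  next
    case (Suc k)
    have "drift N g n k x * real_weight N k m x = (real n / \<kappa> k) * ((1 - g) * S N x n (Suc m) / \<kappa> m)"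
      using Suc by (simp add: real_weight drift_def C_entry_def)
    also have "real n / \<kappa> k = (real (Suc N) - real n) / \<kappa> n"
      using choose_quotients(2)[OF assms(1) Suc] Suc by (simp add: \<kappa>_def del: binomial_Suc_Suc)
    finally show ?thesis using Suc by simp
  qed
  ultimately show ?thesis by (simp add: \<kappa>_def add_divide_distrib diff_divide_distrib)
qed

text \<open>Both products \<open>\<beta> W\<close> and \<open>(\<beta> W)\<^sup>t\<close>, with \<open>\<beta>\<close> the drift, are expressed through the same three
  sine sums, so that they can be added and subtracted.\<close>
lemma drift_weight_split:
  assumes "n \<le> N" "m \<le> N"
  defines "S \<equiv> \<lambda>N x. sinesum (Suc N) (arccos x)"
    and "e \<equiv> \<lambda>N x n m. real (Suc N choose n) * real (Suc N choose m) * sin ((real n - real m) * arccos x)"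
  shows "drift_weight N g n m x = ((real n + 1) * (1 + g) * S N x (Suc (Suc n)) (Suc m)
      + (real (Suc N) - real n) * (1 - g) * (S N x (Suc n) m + e N x n m)
      - x * U_entry N g n * S N x (Suc n) (Suc m)) / (real (N choose n) * real (N choose m))"
    and "drift_weight N g m n x = ((real m + 1) * (1 + g) * (S N x (Suc (Suc n)) (Suc m) + e N x (Suc n) (Suc m))
      + (real (Suc N) - real m) * (1 - g) * S N x (Suc n) m
      - x * U_entry N g m * S N x (Suc n) (Suc m)) / (real (N choose n) * real (N choose m))"
proof -
  show "drift_weight N g n m x = ((real n + 1) * (1 + g) * S N x (Suc (Suc n)) (Suc m)
      + (real (Suc N) - real n) * (1 - g) * (S N x (Suc n) m + e N x n m)
      - x * U_entry N g n * S N x (Suc n) (Suc m)) / (real (N choose n) * real (N choose m))"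
    unfolding drift_weight_explicit[OF assms(1,2)] S_def e_def by (simp only: sinesum.simps(2)[of _ _ n])
  have "drift_weight N g m n x = ((real m + 1) * (1 + g) * S N x (Suc n) (Suc (Suc m))
      + (real (Suc N) - real m) * (1 - g) * S N x (Suc n) m
      - x * U_entry N g m * S N x (Suc n) (Suc m)) / (real (N choose n) * real (N choose m))"
    unfolding drift_weight_explicit[OF assms(2,1)] S_def
    by (simp only: sinesum_sym[of N _ "Suc (Suc m)" "Suc n"] sinesum_sym[of N _ m "Suc n"]
        sinesum_sym[of N _ "Suc m" "Suc n"] mult.commute[of "real (N choose m)"])
  also have "S N x (Suc n) (Suc (Suc m)) = S N x (Suc (Suc n)) (Suc m) + e N x (Suc n) (Suc m)"
    unfolding S_def e_def by (rule sinesum.simps(2))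
  finally show "drift_weight N g m n x = ((real m + 1) * (1 + g) * (S N x (Suc (Suc n)) (Suc m) + e N x (Suc n) (Suc m))
      + (real (Suc N) - real m) * (1 - g) * S N x (Suc n) m
      - x * U_entry N g m * S N x (Suc n) (Suc m)) / (real (N choose n) * real (N choose m))" .
qed

lemma has_real_derivative_arccos_comp:
  assumes "(f has_real_derivative D) (at (arccos x))" "-1 < x" "x < 1"
  shows "((\<lambda>x. f (arccos x)) has_real_derivative - (D / sqrt (1 - x\<^sup>2))) (at x)"
proof -
  have "((\<lambda>x. f (arccos x)) has_real_derivative D * inverse (- sqrt (1 - x\<^sup>2))) (at x)"
    by (rule DERIV_chain2[OF assms(1) DERIV_arccos[OF assms(2,3)]])
  then show ?thesis by (simp add: divide_inverse)
qed

lemma real_weight_has_derivative: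
  assumes "-1 < x" "x < 1"
  shows "((\<lambda>x. real_weight N n m x) has_real_derivative - (real_weight_dtheta N n m x / sqrt (1 - x\<^sup>2))) (at x)"
  unfolding real_weight_def real_weight_dtheta_def
  by (rule has_real_derivative_arccos_comp[OF _ assms]) (rule DERIV_cdivide has_real_derivative_sinesum)+

text \<open>The coefficient of \<open>g\<close> vanishes by \<open>sinesum_skew\<close>; the rest is \<open>sinesum_pearson\<close>.\<close>
lemma drift_weight_sum:
  assumes "n \<le> N" "m \<le> N" "-1 \<le> x" "x \<le> 1"
  shows "(drift_weight N g n m x + drift_weight N g m n x) / 2 = - 2 * x * real_weight N n m x - sqrt (1 - x\<^sup>2) * real_weight_dtheta N n m x"
proof -
  define \<theta> where "\<theta> = arccos x"
  have x: "cos \<theta> = x" "sin \<theta> = sqrt (1 - x\<^sup>2)"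
    using assms by (simp_all add: \<theta>_def sin_arccos)
  define k where "k = real (N choose n) * real (N choose m)"
  define S2 S1 S T A B where "S2 = sinesum (Suc N) \<theta> (Suc (Suc n)) (Suc m)"
    and "S1 = sinesum (Suc N) \<theta> (Suc n) m" and "S = sinesum (Suc N) \<theta> (Suc n) (Suc m)"
    and "T = sinesum_deriv (Suc N) \<theta> (Suc n) (Suc m)"
    and "A = real (Suc N choose n) * real (Suc N choose m) * sin ((real n - real m) * \<theta>)"
    and "B = real (Suc N choose Suc n) * real (Suc N choose Suc m) * sin ((real (Suc n) - real (Suc m)) * \<theta>)"
  have I1: "(real n + real m + 2) * S2 - (2 * (real N + 1) - real n - real m) * S1
     - 2 * (real N - real n - real m) * x * S = (real N + 1 - real n) * A - (real m + 1) * B"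
    using sinesum_skew[where \<theta>=\<theta> and n=n and m=m and M="Suc N"] unfolding S2_def S1_def S_def A_def B_def x(1)
    by (simp add: algebra_simps del: sinesum.simps binomial_Suc_Suc)
  have I3: "(real n + real m + 2) * S2 + (2 * (real N + 1) - real n - real m) * S1
     + ((real N + 1 - real n) * A + (real m + 1) * B) = 2 * (real N + 1) * x * S - 2 * sqrt (1 - x\<^sup>2) * T"
    using sinesum_pearson[where \<theta>=\<theta> and n=n and m=m and M="Suc N"] unfolding S2_def S1_def S_def T_def A_def B_def x
    by (simp add: algebra_simps del: sinesum.simps sinesum_deriv.simps binomial_Suc_Suc)
  have "drift_weight N g n m x + drift_weight N g m n x
    = (((real n + real m + 2) * S2 + (2 * (real N + 1) - real n - real m) * S1
     + ((real N + 1 - real n) * A + (real m + 1) * B) - 2 * x * (real N + 3) * S)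
     + g * ((real n + real m + 2) * S2 - (2 * (real N + 1) - real n - real m) * S1
     - 2 * (real N - real n - real m) * x * S - ((real N + 1 - real n) * A - (real m + 1) * B))) / k"
    unfolding drift_weight_split[OF assms(1,2)] \<theta>_def[symmetric] S2_def[symmetric] S1_def[symmetric]
      S_def[symmetric] A_def[symmetric] B_def[symmetric] k_def[symmetric] add_divide_distrib[symmetric]
    by (simp add: U_entry_def algebra_simps)
  also have "\<dots> = (- 4 * x * S - 2 * sqrt (1 - x\<^sup>2) * T) / k"
    unfolding I1 I3 by (simp add: algebra_simps)
  finally have "drift_weight N g n m x + drift_weight N g m n x = (- 4 * x * S - 2 * sqrt (1 - x\<^sup>2) * T) / k" .
  moreover have "real_weight N n m x = S / k" "real_weight_dtheta N n m x = T / k"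
    unfolding real_weight_def real_weight_dtheta_def \<theta>_def S_def T_def k_def by (rule refl)+
  ultimately show ?thesis by (simp only: diff_divide_distrib) simp
qed

lemma weight_pearson_equation:
  assumes "n \<le> N" "m \<le> N" "-1 < x" "x < 1"
  shows "((\<lambda>x. (1 - x\<^sup>2) * real_weight N n m x) has_real_derivative (drift_weight N g n m x + drift_weight N g m n x) / 2) (at x)"
proof -
  have s: "(1 - x\<^sup>2) / sqrt (1 - x\<^sup>2) = sqrt (1 - x\<^sup>2)"
    by (rule real_div_sqrt) (use assms in \<open>simp add: abs_square_le_1\<close>)
  have "((\<lambda>x. (1 - x\<^sup>2) * real_weight N n m x) has_real_derivative
      (- (2 * x)) * real_weight N n m x + - (real_weight_dtheta N n m x / sqrt (1 - x\<^sup>2)) * (1 - x\<^sup>2)) (at x)"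
    by (intro DERIV_mult real_weight_has_derivative assms) (auto intro!: derivative_eq_intros)
  also have "(- (2 * x)) * real_weight N n m x + - (real_weight_dtheta N n m x / sqrt (1 - x\<^sup>2)) * (1 - x\<^sup>2)
      = - 2 * x * real_weight N n m x - ((1 - x\<^sup>2) / sqrt (1 - x\<^sup>2)) * real_weight_dtheta N n m x"
    by simp
  finally show ?thesis unfolding s drift_weight_sum[OF assms(1,2) less_imp_le[OF assms(3)] less_imp_le[OF assms(4)]] .
qed

text \<open>With \<open>Z = (\<beta> W - W \<beta>\<^sup>t) / 2\<close> this is \<open>Z' = W V\<^sup>t - V W\<close>. As \<open>V\<close> is diagonal, the right-hand side
  is \<open>W\<^sub>n\<^sub>m (V\<^sub>m - V\<^sub>n)\<close>; it has the factor \<open>n - m\<close>, like the derivative of \<open>Z\<close>.\<close>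
lemma weight_second_order_equation:
  assumes "n \<le> N" "m \<le> N" "-1 < x" "x < 1"
  shows "((\<lambda>x. (drift_weight N g n m x - drift_weight N g m n x) / 2) has_real_derivative
           real_weight N n m x * (V_entry N g m - V_entry N g n)) (at x)"
proof -
  define k d where "k = real (N choose n) * real (N choose m)" and "d = real n - real m"
  define \<theta> where "\<theta> = arccos x"
  have sn: "sin \<theta> = sqrt (1 - x\<^sup>2)" "sqrt (1 - x\<^sup>2) \<noteq> 0" "cos \<theta> = x"
    using assms abs_square_eq_1[of x] by (auto simp: \<theta>_def sin_arccos)
  define a b where "a = (real N + 1 - real n) * real (Suc N choose m) * real (Suc N choose n)"
    and "b = (real m + 1) * real (Suc N choose Suc m) * real (Suc N choose Suc n)"
  define S2 S1 S where "S2 = (\<lambda>\<theta>. sinesum (Suc N) \<theta> (Suc (Suc n)) (Suc m))"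
    and "S1 = (\<lambda>\<theta>. sinesum (Suc N) \<theta> (Suc n) m)" and "S = (\<lambda>\<theta>. sinesum (Suc N) \<theta> (Suc n) (Suc m))"
  define T2 T1 T where "T2 = (\<lambda>\<theta>. sinesum_deriv (Suc N) \<theta> (Suc (Suc n)) (Suc m))"
    and "T1 = (\<lambda>\<theta>. sinesum_deriv (Suc N) \<theta> (Suc n) m)" and "T = (\<lambda>\<theta>. sinesum_deriv (Suc N) \<theta> (Suc n) (Suc m))"
  \<comment> \<open>The skew part as a function of \<open>\<theta>\<close>; the part without \<open>g\<close> and the part with \<open>g\<close> are
    differentiated separately.\<close>
  define Z where "Z \<theta> = (((d * (S2 \<theta> - S1 \<theta>) + (a - b) * sin (d * \<theta>))
     + g * (d * (S2 \<theta> + S1 \<theta>) - (a + b) * sin (d * \<theta>) + 2 * d * (cos \<theta> * S \<theta>)))) / (2 * k)" for \<theta>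
  have Z: "(drift_weight N g n m y - drift_weight N g m n y) / 2 = Z (arccos y)" if "-1 < y" "y < 1" for y
  proof -
    have y: "y = cos (arccos y)" using that by simp
    define P Q R E F where "P = S2 (arccos y)" and "Q = S1 (arccos y)" and "R = S (arccos y)"
      and "E = sin ((real n - real m) * arccos y)"
      and "F = sin ((real (Suc n) - real (Suc m)) * arccos y)"
    have EF: "F = E" by (simp add: E_def F_def)
    have "drift_weight N g n m y - drift_weight N g m n y
      = (((real n + 1) * (1 + g) * P + (real (Suc N) - real n) * (1 - g) * (Q + real (Suc N choose n) * real (Suc N choose m) * E)
          - y * U_entry N g n * R)
        - ((real m + 1) * (1 + g) * (P + real (Suc N choose Suc n) * real (Suc N choose Suc m) * F)
          + (real (Suc N) - real m) * (1 - g) * Q - y * U_entry N g m * R)) / k"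
      unfolding drift_weight_split[OF assms(1,2)] diff_divide_distrib k_def P_def Q_def R_def E_def F_def
        S2_def S1_def S_def by (rule refl)
    also have "\<dots> = (d * (P - Q) + (a - b) * E + g * (d * (P + Q) - (a + b) * E + 2 * d * (y * R))) / k"
      unfolding d_def a_def b_def EF U_entry_def of_nat_Suc
      by (intro arg_cong2[of _ _ _ _ "(/)"] refl) (simp add: algebra_simps del: binomial_Suc_Suc)
    also have "\<dots> = 2 * Z (arccos y)"
    proof -
      have two: "2 * (X / (2 * k)) = X / k" for X by simp
      show ?thesis unfolding Z_def two P_def Q_def R_def E_def d_def y[symmetric] by (rule refl)
    qed
    finally have "drift_weight N g n m y - drift_weight N g m n y = 2 * Z (arccos y)" .
    then show ?thesis by simp
  qed
  have dS: "(S2 has_real_derivative T2 \<theta>) (at \<theta>)" "(S1 has_real_derivative T1 \<theta>) (at \<theta>)"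
    "(S has_real_derivative T \<theta>) (at \<theta>)" for \<theta>
    unfolding S2_def S1_def S_def T2_def T1_def T_def by (rule has_real_derivative_sinesum)+
  have "(Z has_real_derivative d * ((T2 \<theta> - T1 \<theta> + (a - b) * cos (d * \<theta>))
      + g * (T2 \<theta> + T1 \<theta> - (a + b) * cos (d * \<theta>) + 2 * (cos \<theta> * T \<theta> - sin \<theta> * S \<theta>))) / (2 * k)) (at \<theta>)"
    unfolding Z_def
    by (rule DERIV_cdivide, rule DERIV_cong, (rule derivative_eq_intros dS refl)+) (simp add: algebra_simps)
  moreover have "T2 \<theta> - T1 \<theta> + (a - b) * cos (d * \<theta>) = - (2 * (real N - real n - real m) * sin \<theta> * S \<theta>)"
    using sinesum_deriv_second_order[where \<theta>=\<theta> and n=n and m=m and M="Suc N"] unfolding T2_def T1_def S_def a_def b_def d_def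
    by (simp add: algebra_simps del: sinesum.simps sinesum_deriv.simps binomial_Suc_Suc)
  moreover have "T2 \<theta> + T1 \<theta> - (a + b) * cos (d * \<theta>) + 2 * (cos \<theta> * T \<theta> - sin \<theta> * S \<theta>)
      = - (2 * (real N + 2) * sin \<theta> * S \<theta>)"
    using sinesum_deriv_first_order[where \<theta>=\<theta> and n=n and m=m and M="Suc N"] unfolding T2_def T1_def S_def T_def a_def b_def d_def
    by (simp add: algebra_simps del: sinesum.simps sinesum_deriv.simps binomial_Suc_Suc)
  ultimately have "(Z has_real_derivative d * (- (2 * (real N - real n - real m) * sin \<theta> * S \<theta>)
      + g * (- (2 * (real N + 2) * sin \<theta> * S \<theta>))) / (2 * k)) (at (arccos x))"
    by (simp only: \<theta>_def)
  then have "(Z has_real_derivative - (sin \<theta> * (S \<theta> / k * (d * (real N - real n - real m + g * (real N + 2)))))) (at (arccos x))"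
    by (rule DERIV_cong) (simp add: algebra_simps add_divide_distrib diff_divide_distrib)
  from has_real_derivative_arccos_comp[OF this assms(3,4)]
  have "((\<lambda>x. Z (arccos x)) has_real_derivative
      - (- (sin \<theta> * (S \<theta> / k * (d * (real N - real n - real m + g * (real N + 2))))) / sqrt (1 - x\<^sup>2))) (at x)" .
  also have "- (- (sin \<theta> * (S \<theta> / k * (d * (real N - real n - real m + g * (real N + 2))))) / sqrt (1 - x\<^sup>2))
      = S \<theta> / k * (d * (real N - real n - real m + g * (real N + 2)))"
    using sn(2) unfolding sn(1) by simp
  also have "d * (real N - real n - real m + g * (real N + 2)) = V_entry N g m - V_entry N g n"
    unfolding V_entry_def d_def by (simp add: algebra_simps)
  also have "S \<theta> / k = real_weight N n m x" by (simp add: real_weight_def S_def k_def \<theta>_def del: sinesum.simps)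
  finally have "((\<lambda>x. Z (arccos x)) has_real_derivative real_weight N n m x * (V_entry N g m - V_entry N g n)) (at x)" .
  then show ?thesis
    by (rule has_field_derivative_transform_within_open[of _ _ _ "{-1<..<1}"]) (use assms Z in auto)
qed

section \<open>A hypergeometric operator that is symmetric for the weight\<close>
definition drift_poly :: "nat \<Rightarrow> real \<Rightarrow> nat \<Rightarrow> nat \<Rightarrow> complex poly" where
  "drift_poly N g k l = [: of_real ((if k = l then U_entry N g k else 0) - 2 * C_entry N g k l),
     of_real (if k = l then - U_entry N g k else 0) :]"

lemma poly_drift_poly: "poly (drift_poly N g k l) (of_real x) = of_real (drift N g k l x)"
  by (simp add: drift_poly_def drift_def algebra_simps)

text \<open>The operator \<open>F \<mapsto> u (1 - u) F'' + F' (C\<^sub>\<alpha> - u U\<^sub>\<alpha>) - F V\<^sub>\<alpha>\<close> on row vectors of polynomials,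
  in the variable \<open>x = 1 - 2 u\<close>.\<close>
definition hyp_op :: "nat \<Rightarrow> real \<Rightarrow> (nat \<Rightarrow> complex poly) \<Rightarrow> nat \<Rightarrow> complex poly" where
  "hyp_op N g F l = [:1, 0, -1:] * pderiv (pderiv (F l)) + (\<Sum>k\<le>N. drift_poly N g k l * pderiv (F k))
     - Polynomial.smult (of_real (V_entry N g l)) (F l)"

text \<open>The integrand of the pairing \<open>\<integral> F W G\<^sup>t\<close>. It is bilinear and not sesquilinear: then it is
  symmetric, and all calculus is done without complex conjugation.\<close>
definition form :: "nat \<Rightarrow> (nat \<Rightarrow> complex poly) \<Rightarrow> (nat \<Rightarrow> complex poly) \<Rightarrow> real \<Rightarrow> complex" where
  "form N F G x = (\<Sum>k\<le>N. \<Sum>l\<le>N.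
     poly (F k) (of_real x) * of_real (real_weight N k l x) * poly (G l) (of_real x))"

lemma poly_of_real_has_vector_derivative:
  "((\<lambda>x. poly p (complex_of_real x)) has_vector_derivative poly (pderiv p) (of_real x)) (at x)"
  by (rule has_vector_derivative_real_field) (rule poly_DERIV)

lemma continuous_on_real_weight: "continuous_on {-1..1} (\<lambda>x. real_weight N n m x)"
proof -
  have "continuous_on UNIV (\<lambda>\<theta>. sinesum M \<theta> n m)" for M n m
    by (rule DERIV_continuous_on) (rule has_real_derivative_sinesum)
  then have "continuous_on {-1..1} (\<lambda>x. sinesum (Suc N) (arccos x) (Suc n) (Suc m))"
    by (rule continuous_on_compose2[OF _ continuous_on_arccos']) auto
  then show ?thesis unfolding real_weight_def divide_inverse by (intro continuous_intros)
qed

lemma continuous_on_form: "continuous_on {-1..1} (form N F G)"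
  unfolding form_def by (intro continuous_intros continuous_on_real_weight)

lemma continuous_on_drift_weight: "continuous_on {-1..1} (\<lambda>x. drift_weight N g n m x)"
proof -
  have "continuous_on {-1..1} (\<lambda>x. drift N g n k x)" for k
    unfolding drift_def by (cases "n = k") (simp_all, intro continuous_intros)
  then show ?thesis unfolding drift_weight_def by (intro continuous_intros continuous_on_real_weight)
qed

lemma real_weight_endpoints: "real_weight N n m 1 = 0" "real_weight N n m (-1) = 0"
proof -
  have "complex_of_real (real_weight N n m 1) = 0" "complex_of_real (real_weight N n m (-1)) = 0"
    by (subst real_weight_gram; simp)+
  then show "real_weight N n m 1 = 0" "real_weight N n m (-1) = 0" by simp_all
qed

lemma drift_weight_endpoints: "drift_weight N g n m 1 = 0" "drift_weight N g n m (-1) = 0"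
  by (simp_all add: drift_weight_def real_weight_endpoints)

lemma form_hyp_op_left:
  "form N (hyp_op N g F) G x = (\<Sum>k\<le>N. \<Sum>l\<le>N.
     of_real (1 - x\<^sup>2) * of_real (real_weight N k l x) * poly (pderiv (pderiv (F k))) (of_real x) * poly (G l) (of_real x)
     + poly (pderiv (F k)) (of_real x) * of_real (drift_weight N g k l x) * poly (G l) (of_real x)
     - of_real (V_entry N g k) * poly (F k) (of_real x) * of_real (real_weight N k l x) * poly (G l) (of_real x))"
proof -
  have "(\<Sum>k\<le>N. \<Sum>l\<le>N. (\<Sum>j\<le>N. of_real (drift N g j k x) * poly (pderiv (F j)) (of_real x))
         * of_real (real_weight N k l x) * poly (G l) (of_real x))
     = (\<Sum>k\<le>N. \<Sum>l\<le>N. \<Sum>j\<le>N. poly (pderiv (F j)) (of_real x)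
          * of_real (drift N g j k x * real_weight N k l x) * poly (G l) (of_real x))"
    by (simp add: sum_distrib_left sum_distrib_right mult_ac)
  also have "\<dots> = (\<Sum>k\<le>N. \<Sum>j\<le>N. \<Sum>l\<le>N. poly (pderiv (F j)) (of_real x)
          * of_real (drift N g j k x * real_weight N k l x) * poly (G l) (of_real x))"
    by (intro sum.cong refl sum.swap)
  also have "\<dots> = (\<Sum>j\<le>N. \<Sum>k\<le>N. \<Sum>l\<le>N. poly (pderiv (F j)) (of_real x)
          * of_real (drift N g j k x * real_weight N k l x) * poly (G l) (of_real x))"
    by (rule sum.swap)
  also have "\<dots> = (\<Sum>j\<le>N. \<Sum>l\<le>N. \<Sum>k\<le>N. poly (pderiv (F j)) (of_real x)
          * of_real (drift N g j k x * real_weight N k l x) * poly (G l) (of_real x))"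
    by (intro sum.cong refl sum.swap)
  also have "\<dots> = (\<Sum>j\<le>N. \<Sum>l\<le>N. poly (pderiv (F j)) (of_real x) * of_real (drift_weight N g j l x) * poly (G l) (of_real x))"
    by (simp add: drift_weight_def sum_distrib_left sum_distrib_right)
  finally have *: "(\<Sum>k\<le>N. \<Sum>l\<le>N. (\<Sum>j\<le>N. of_real (drift N g j k x) * poly (pderiv (F j)) (of_real x))
         * of_real (real_weight N k l x) * poly (G l) (of_real x))
    = (\<Sum>j\<le>N. \<Sum>l\<le>N. poly (pderiv (F j)) (of_real x) * of_real (drift_weight N g j l x) * poly (G l) (of_real x))" .
  have h: "poly (hyp_op N g F k) (of_real x) = of_real (1 - x\<^sup>2) * poly (pderiv (pderiv (F k))) (of_real x)
      + (\<Sum>j\<le>N. of_real (drift N g j k x) * poly (pderiv (F j)) (of_real x))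
      - of_real (V_entry N g k) * poly (F k) (of_real x)" for k
    by (simp add: hyp_op_def poly_sum poly_drift_poly power2_eq_square algebra_simps)
  have "form N (hyp_op N g F) G x = (\<Sum>k\<le>N. \<Sum>l\<le>N.
      (of_real (1 - x\<^sup>2) * of_real (real_weight N k l x) * poly (pderiv (pderiv (F k))) (of_real x) * poly (G l) (of_real x)
       - of_real (V_entry N g k) * poly (F k) (of_real x) * of_real (real_weight N k l x) * poly (G l) (of_real x))
      + (\<Sum>j\<le>N. of_real (drift N g j k x) * poly (pderiv (F j)) (of_real x))
         * of_real (real_weight N k l x) * poly (G l) (of_real x))"
    unfolding form_def h by (intro sum.cong refl) (simp only: ring_distribs, simp add: mult_ac)
  also have "\<dots> = (\<Sum>k\<le>N. \<Sum>l\<le>N.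
      of_real (1 - x\<^sup>2) * of_real (real_weight N k l x) * poly (pderiv (pderiv (F k))) (of_real x) * poly (G l) (of_real x)
       - of_real (V_entry N g k) * poly (F k) (of_real x) * of_real (real_weight N k l x) * poly (G l) (of_real x))
      + (\<Sum>k\<le>N. \<Sum>l\<le>N. poly (pderiv (F k)) (of_real x) * of_real (drift_weight N g k l x) * poly (G l) (of_real x))"
    unfolding sum.distrib * ..
  finally show ?thesis
    unfolding sum.distrib[symmetric] by (simp only: add_diff_eq diff_add_eq)
qed

lemma form_sym: "form N F G x = form N G F x"
proof -
  have "form N F G x = (\<Sum>l\<le>N. \<Sum>k\<le>N.
     poly (F k) (of_real x) * of_real (real_weight N k l x) * poly (G l) (of_real x))"
    unfolding form_def by (rule sum.swap)
  also have "\<dots> = form N G F x"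
    unfolding form_def by (intro sum.cong refl, subst real_weight_sym, simp only: mult_ac)
  finally show ?thesis .
qed

lemma form_term_identity:
  fixes a :: complex
  shows "a * w * (f1 * g1 + f2 * g0 - (f0 * g2 + f1 * g1)) + (b + b') / 2 * (f1 * g0 - f0 * g1)
     + ((b - b') / 2 * (f0 * g1 + f1 * g0) + w * (v' - v) * (f0 * g0))
   = a * w * f2 * g0 + f1 * b * g0 - v * f0 * w * g0 - (a * w * f0 * g2 + f0 * b' * g1 - v' * f0 * w * g0)"
  by (simp add: field_simps)

text \<open>The bilinear concomitant \<open>\<Phi> = (1 - x\<^sup>2) (F' W G\<^sup>t - F W G'\<^sup>t) + F Z G\<^sup>t\<close> is an antiderivative of
  the difference of the two integrands: the terms with \<open>F' G\<^sup>t\<close>, \<open>F G'\<^sup>t\<close> and \<open>F G\<^sup>t\<close> match by the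
  two equations of the weight. There are no boundary terms, because \<open>W\<close> has the factor
  \<open>sqrt (1 - x\<^sup>2)\<close>, so that \<open>W\<close> and \<open>Z\<close> vanish at both endpoints.\<close>
lemma hyp_op_symmetric:
  "((\<lambda>x. form N (hyp_op N g F) G x - form N F (hyp_op N g G) x) has_integral 0) {-1..1}"
proof -
  define Z where "Z k l x = (drift_weight N g k l x - drift_weight N g l k x) / 2" for k l x
  define \<Phi> where "\<Phi> x = (\<Sum>k\<le>N. \<Sum>l\<le>N. of_real ((1 - x\<^sup>2) * real_weight N k l x)
     * (poly (pderiv (F k)) (of_real x) * poly (G l) (of_real x) - poly (F k) (of_real x) * poly (pderiv (G l)) (of_real x))
     + of_real (Z k l x) * (poly (F k) (of_real x) * poly (G l) (of_real x)))" for x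
  have right: "form N F (hyp_op N g G) x = (\<Sum>k\<le>N. \<Sum>l\<le>N.
     of_real (1 - x\<^sup>2) * of_real (real_weight N k l x) * poly (F k) (of_real x) * poly (pderiv (pderiv (G l))) (of_real x)
     + poly (F k) (of_real x) * of_real (drift_weight N g l k x) * poly (pderiv (G l)) (of_real x)
     - of_real (V_entry N g l) * poly (F k) (of_real x) * of_real (real_weight N k l x) * poly (G l) (of_real x))" for x
    unfolding form_sym[of N F] form_hyp_op_left
    by (subst sum.swap) (intro sum.cong refl, simp only: real_weight_sym mult_ac)
  have "(\<Phi> has_vector_derivative form N (hyp_op N g F) G x - form N F (hyp_op N g G) x) (at x)"
    if x: "x \<in> {-1<..<1}" for x
  proof -
    define f0 f1 f2 where "f0 k = poly (F k) (of_real x)" and "f1 k = poly (pderiv (F k)) (of_real x)"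
      and "f2 k = poly (pderiv (pderiv (F k))) (of_real x)" for k
    define g0 g1 g2 where "g0 k = poly (G k) (of_real x)" and "g1 k = poly (pderiv (G k)) (of_real x)"
      and "g2 k = poly (pderiv (pderiv (G k))) (of_real x)" for k
    have "(\<Phi> has_vector_derivative (\<Sum>k\<le>N. \<Sum>l\<le>N.
        (of_real ((1 - x\<^sup>2) * real_weight N k l x) * ((f1 k * g1 l + f2 k * g0 l) - (f0 k * g2 l + f1 k * g1 l))
         + of_real ((drift_weight N g k l x + drift_weight N g l k x) / 2) * (f1 k * g0 l - f0 k * g1 l))
        + (of_real (Z k l x) * (f0 k * g1 l + f1 k * g0 l)
         + of_real (real_weight N k l x * (V_entry N g l - V_entry N g k)) * (f0 k * g0 l)))) (at x)"
      unfolding \<Phi>_def f0_def f1_def f2_def g0_def g1_def g2_def Z_def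
      by (intro has_vector_derivative_sum has_vector_derivative_add has_vector_derivative_diff
          has_vector_derivative_mult has_vector_derivative_of_real poly_of_real_has_vector_derivative
          weight_pearson_equation weight_second_order_equation)
        (use x in auto)
    also have "(\<Sum>k\<le>N. \<Sum>l\<le>N.
        (of_real ((1 - x\<^sup>2) * real_weight N k l x) * ((f1 k * g1 l + f2 k * g0 l) - (f0 k * g2 l + f1 k * g1 l))
         + of_real ((drift_weight N g k l x + drift_weight N g l k x) / 2) * (f1 k * g0 l - f0 k * g1 l))
        + (of_real (Z k l x) * (f0 k * g1 l + f1 k * g0 l)
         + of_real (real_weight N k l x * (V_entry N g l - V_entry N g k)) * (f0 k * g0 l)))
       = form N (hyp_op N g F) G x - form N F (hyp_op N g G) x"
      unfolding form_hyp_op_left right sum_subtractf[symmetric] f0_def[symmetric] f1_def[symmetric]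
        f2_def[symmetric] g0_def[symmetric] g1_def[symmetric] g2_def[symmetric] Z_def
        of_real_mult of_real_diff of_real_add of_real_divide of_real_numeral
      by (intro sum.cong refl) (rule form_term_identity)
    finally show ?thesis .
  qed
  moreover have "continuous_on {-1..1} \<Phi>"
    unfolding \<Phi>_def Z_def by (intro continuous_intros continuous_on_real_weight continuous_on_drift_weight) simp_all
  ultimately have "((\<lambda>x. form N (hyp_op N g F) G x - form N F (hyp_op N g G) x) has_integral (\<Phi> 1 - \<Phi> (-1))) {-1..1}"
    by (intro fundamental_theorem_of_calculus_interior) auto
  moreover have "\<Phi> 1 = 0" "\<Phi> (-1) = 0"
    by (simp_all add: \<Phi>_def Z_def drift_weight_endpoints real_weight_endpoints)
  ultimately show ?thesis by simp
qed

section \<open>Orthogonal polynomials are eigenfunctions\<close>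
abbreviation conj_row :: "(nat \<Rightarrow> complex poly) \<Rightarrow> nat \<Rightarrow> complex poly" where
  "conj_row G \<equiv> \<lambda>l. map_poly cnj (G l)"

lemma form_conj_row:
  "form N F (conj_row G) x = (\<Sum>k\<le>N. \<Sum>l\<le>N.
     poly (F k) (of_real x) * of_real (real_weight N k l x) * cnj (poly (G l) (of_real x)))"
  by (simp add: form_def)

lemma form_diff_smult:
  "form N (\<lambda>l. F l - Polynomial.smult c (F' l)) G x = form N F G x - c * form N F' G x"
  unfolding form_def sum_distrib_left sum_subtractf[symmetric]
  by (intro sum.cong refl) (simp add: algebra_simps)

lemma form_gram:
  assumes "-1 \<le> x" "x \<le> 1"
  shows "form N H (conj_row H) x = of_real (sqrt (1 - x\<^sup>2) * (\<Sum>j\<le>N.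
      (cmod (\<Sum>k\<le>N. poly (H k) (of_real x) * (gram_vec N (cis (arccos x)) j k / of_nat (N choose k))))\<^sup>2))"
proof -
  define D where "D j k = gram_vec N (cis (arccos x)) j k / of_nat (N choose k)" for j k
  define h where "h k = poly (H k) (of_real x)" for k
  define s where "s = complex_of_real (sqrt (1 - x\<^sup>2))"
  have "form N H (conj_row H) x = (\<Sum>k\<le>N. \<Sum>l\<le>N. \<Sum>j\<le>N. s * ((h k * D j k) * cnj (h l * D j l)))"
    unfolding form_conj_row real_weight_gram[OF assms]
    by (simp add: h_def D_def s_def sum_distrib_left sum_distrib_right mult_ac)
  also have "\<dots> = (\<Sum>k\<le>N. \<Sum>j\<le>N. \<Sum>l\<le>N. s * ((h k * D j k) * cnj (h l * D j l)))"
    by (intro sum.cong refl sum.swap)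
  also have "\<dots> = (\<Sum>j\<le>N. \<Sum>k\<le>N. \<Sum>l\<le>N. s * ((h k * D j k) * cnj (h l * D j l)))"
    by (rule sum.swap)
  also have "\<dots> = s * (\<Sum>j\<le>N. (\<Sum>k\<le>N. h k * D j k) * cnj (\<Sum>l\<le>N. h l * D j l))"
    by (simp only: cnj_sum sum_product) (simp only: sum_distrib_left)
  also have "\<dots> = s * (\<Sum>j\<le>N. of_real ((cmod (\<Sum>k\<le>N. h k * D j k))\<^sup>2))"
    by (simp only: complex_norm_square)
  finally show ?thesis by (simp add: s_def h_def D_def)
qed

text \<open>By the Gram factorization the integrand is a nonnegative continuous function, so it vanishes
  everywhere. At each interior point the row of values is then orthogonal to all Gram vectors,
  hence zero.\<close>
lemma form_definite:
  assumes "(form N H (conj_row H) has_integral 0) {-1..1}" and "l \<le> N"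
  shows "H l = 0"
proof -
  define q where "q x = sqrt (1 - x\<^sup>2) * (\<Sum>j\<le>N. (cmod (\<Sum>k\<le>N. poly (H k) (of_real x)
      * (gram_vec N (cis (arccos x)) j k / of_nat (N choose k))))\<^sup>2)" for x
  have q: "Re (form N H (conj_row H) x) = q x" if "x \<in> {-1..1}" for x
    using form_gram[of x N H] that by (simp add: q_def)
  have "((Re \<circ> form N H (conj_row H)) has_integral Re 0) {-1..1}"
    by (rule has_integral_linear[OF assms(1) bounded_linear_Re])
  then have int: "((\<lambda>x. Re (form N H (conj_row H) x)) has_integral 0) (cbox (-1) 1)"
    by (simp add: o_def)
  have q_nonneg: "q x \<ge> 0" if "x \<in> {-1..1}" for x
    using that by (auto simp: q_def abs_square_le_1 abs_le_iff intro!: mult_nonneg_nonneg sum_nonneg)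
  have "poly (H l) (of_real x) = 0" if x: "x \<in> {-1<..<1}" for x
  proof -
    have "Re (form N H (conj_row H) x) = 0"
    proof (rule has_integral_0_cbox_imp_0[OF _ _ int])
      show "continuous_on (cbox (-1) 1) (\<lambda>x. Re (form N H (conj_row H) x))"
        using continuous_on_form by (auto intro!: continuous_intros)
    qed (use x q q_nonneg in auto)
    then have "q x = 0" using q x by simp
    moreover have s: "sqrt (1 - x\<^sup>2) \<noteq> 0" using x abs_square_eq_1[of x] by auto
    ultimately have "(\<Sum>k\<le>N. poly (H k) (of_real x)
      * (gram_vec N (cis (arccos x)) j k / of_nat (N choose k))) = 0" if "j \<le> N" for j
      using that by (simp add: q_def sum_nonneg_eq_0_iff)
    then have 0: "(\<Sum>k\<le>N. (poly (H k) (of_real x) / of_nat (N choose k)) * gram_vec N (cis (arccos x)) j k) = 0"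
      if "j \<le> N" for j using that by (simp add: field_simps)
    have "Im (cis (arccos x)) \<noteq> Im (cnj (cis (arccos x)))"
      using s x by (simp add: sin_arccos)
    then have "cis (arccos x) \<noteq> cnj (cis (arccos x))" by metis
    from gram_vec_separating[OF this 0 assms(2)] show ?thesis using assms(2) by simp
  qed
  then have "complex_of_real ` {-1<..<1} \<subseteq> {z. poly (H l) z = 0}" by auto
  moreover have "infinite (complex_of_real ` {-1<..<1})"
    by (subst finite_image_iff) (auto simp: inj_on_def)
  ultimately show ?thesis using poly_roots_finite finite_subset by blast
qed

text \<open>The eigenvalue \<open>\<lambda>\<^sub>n\<^sup>\<alpha>(i)\<close>, read off from the action of the operator on leading terms; see
  \<open>coeff_hyp_op\<close> and \<open>eigval_hyp_eig\<close>.\<close>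
definition hyp_eig :: "nat \<Rightarrow> real \<Rightarrow> nat \<Rightarrow> nat \<Rightarrow> real" where
  "hyp_eig N g n i = - (real n * (real n - 1)) - real n * U_entry N g i - V_entry N g i"

text \<open>The operator does not raise degrees, and it acts on leading coefficients as a diagonal matrix.\<close>
lemma coeff_hyp_op:
  assumes "l \<le> N"
  shows "Polynomial.coeff (hyp_op N g F l) j = of_real (hyp_eig N g j l) * Polynomial.coeff (F l) j
    + of_nat ((j + 2) * (j + 1)) * Polynomial.coeff (F l) (j + 2)
    + (\<Sum>k\<le>N. of_real ((if k = l then U_entry N g k else 0) - 2 * C_entry N g k l)
         * (of_nat (j + 1) * Polynomial.coeff (F k) (j + 1)))"
proof -
  have 1: "Polynomial.coeff ([:1, 0, -1:] * pderiv (pderiv (F l))) j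
    = of_nat ((j + 2) * (j + 1)) * Polynomial.coeff (F l) (j + 2)
      - of_nat j * (of_nat j - 1) * Polynomial.coeff (F l) j"
  proof -
    consider "j = 0" | "j = 1" | k where "j = k + 2"
      by (metis One_nat_def add_2_eq_Suc' not0_implies_Suc)
    then show ?thesis by cases (auto simp: coeff_pderiv algebra_simps numeral_2_eq_2)
  qed
  have lin: "Polynomial.coeff ([:a, b:] * pderiv p) j = a * (of_nat (j + 1) * Polynomial.coeff p (j + 1))
      + b * (of_nat j * Polynomial.coeff p j)" for a b :: complex and p
    by (cases j) (auto simp: coeff_pderiv algebra_simps)
  have "(\<Sum>k\<le>N. Polynomial.coeff (drift_poly N g k l * pderiv (F k)) j)
    = (\<Sum>k\<le>N. of_real ((if k = l then U_entry N g k else 0) - 2 * C_entry N g k l)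
         * (of_nat (j + 1) * Polynomial.coeff (F k) (j + 1)))
      + (\<Sum>k\<le>N. if k = l then - of_real (U_entry N g l) * (of_nat j * Polynomial.coeff (F l) j) else 0)"
    unfolding drift_poly_def lin sum.distrib by (intro arg_cong2[of _ _ _ _ "(+)"] sum.cong refl) auto
  also have "(\<Sum>k\<le>N. if k = l then - of_real (U_entry N g l) * (of_nat j * Polynomial.coeff (F l) j) else 0)
     = - of_real (U_entry N g l) * (of_nat j * Polynomial.coeff (F l) j)"
    using assms by simp
  finally show ?thesis
    unfolding hyp_op_def coeff_diff coeff_add coeff_sum 1 by (simp add: hyp_eig_def algebra_simps)
qed

abbreviation mrow :: "(nat \<Rightarrow> complex poly mat) \<Rightarrow> nat \<Rightarrow> nat \<Rightarrow> nat \<Rightarrow> complex poly" where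
  "mrow P n i \<equiv> \<lambda>k. P n $$ (i, k)"

lemma monic_mvop_coeff:
  assumes "monic_mvop N P" "i \<le> N" "j \<le> N"
  shows "Polynomial.coeff (P n $$ (i, j)) n = (if i = j then 1 else 0)"
    and "n < k \<Longrightarrow> Polynomial.coeff (P n $$ (i, j)) k = 0"
proof -
  have m: "monic_mat_poly (N + 1) n (P n)" using assms(1) by (simp add: monic_mvop_def)
  then have "P n \<in> carrier_mat (N + 1) (N + 1)" "map_mat (\<lambda>p. Polynomial.coeff p n) (P n) = 1\<^sub>m (N + 1)"
    "degree (P n $$ (i, j)) \<le> n"
    using assms(2,3) by (auto simp: monic_mat_poly_def)
  then show "Polynomial.coeff (P n $$ (i, j)) n = (if i = j then 1 else 0)"
    and "n < k \<Longrightarrow> Polynomial.coeff (P n $$ (i, j)) k = 0"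
    using assms(2,3) by (auto simp: mat_eq_iff coeff_eq_0)
qed

lemma monic_mvop_orthogonal:
  assumes "monic_mvop N P" "i \<le> N" "j \<le> N" "n \<noteq> m"
  shows "(form N (mrow P n i) (conj_row (mrow P m j)) has_integral 0) {-1..1}"
proof (rule has_integral_eq)
  show "((\<lambda>x. (eval_mat (P n) (of_real x) * weight N x * mat_adjoint (eval_mat (P m) (of_real x)))
               $$ (i, j)) has_integral 0) {-1..1}"
    using assms by (auto simp: monic_mvop_def)
  fix x :: real assume x: "x \<in> {-1..1}"
  have c: "P n \<in> carrier_mat (N + 1) (N + 1)" "P m \<in> carrier_mat (N + 1) (N + 1)"
    using assms(1) by (auto simp: monic_mvop_def monic_mat_poly_def)
  have W: "weight N x \<in> carrier_mat (N + 1) (N + 1)" by (simp add: weight_def cmat_def)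
  have adj: "mat_adjoint A $$ (k, j) = cnj (A $$ (j, k))"
    if "A \<in> carrier_mat (N + 1) (N + 1)" "k \<le> N" for A and k
    using that assms(3) by (simp add: mat_adjoint_def mat_of_rows_def)
  have adjc: "mat_adjoint A \<in> carrier_mat (N + 1) (N + 1)"
    if "A \<in> carrier_mat (N + 1) (N + 1)" for A :: "complex mat"
    using that by (auto simp: mat_adjoint_def mat_of_rows_def)
  have e: "eval_mat (P n) (of_real x) \<in> carrier_mat (N + 1) (N + 1)"
    "eval_mat (P m) (of_real x) \<in> carrier_mat (N + 1) (N + 1)"
    using c by (simp_all add: eval_mat_def)
  have "(eval_mat (P n) (of_real x) * weight N x * mat_adjoint (eval_mat (P m) (of_real x))) $$ (i, j)
    = (\<Sum>l\<le>N. (\<Sum>k\<le>N. eval_mat (P n) (of_real x) $$ (i, k) * weight N x $$ (k, l))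
         * mat_adjoint (eval_mat (P m) (of_real x)) $$ (l, j))"
    using e W adjc[OF e(2)] assms(2,3)
    by (simp add: scalar_prod_def atLeast0LessThan lessThan_Suc_atMost del: assoc_mult_mat)
  also have "\<dots> = (\<Sum>l\<le>N. \<Sum>k\<le>N. poly (P n $$ (i, k)) (of_real x) * of_real (real_weight N k l x)
         * cnj (poly (P m $$ (j, l)) (of_real x)))"
    unfolding sum_distrib_right
    by (intro sum.cong refl) (use x c e assms(2,3) in \<open>simp add: adj weight_eq_real_weight eval_mat_def\<close>)
  also have "\<dots> = form N (mrow P n i) (conj_row (mrow P m j)) x"
    unfolding form_conj_row by (rule sum.swap)
  finally show "(eval_mat (P n) (of_real x) * weight N x * mat_adjoint (eval_mat (P m) (of_real x))) $$ (i, j)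
     = form N (mrow P n i) (conj_row (mrow P m j)) x" .
qed

text \<open>A row of degree less than \<open>d\<close> is a combination of the rows of \<open>P\<^sub>0, \<dots>, P\<^sub>d\<^sub>-\<^sub>1\<close>, because these are
  monic; the induction removes the leading coefficients one degree at a time.\<close>
lemma monic_mvop_orthogonal_lower:
  assumes P: "monic_mvop N P" and i: "i \<le> N" and "d \<le> n"
    and "\<And>l k. l \<le> N \<Longrightarrow> d \<le> k \<Longrightarrow> Polynomial.coeff (G l) k = 0"
  shows "(form N (mrow P n i) (conj_row G) has_integral 0) {-1..1}"
  using assms(3,4)
proof (induction d arbitrary: G)
  case 0
  then have "G l = 0" if "l \<le> N" for l using that by (simp add: poly_eq_iff)
  then have "form N (mrow P n i) (conj_row G) = (\<lambda>x. 0)"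
    by (simp add: form_conj_row fun_eq_iff)
  then show ?case by simp
next
  case (Suc d)
  define c where "c j = Polynomial.coeff (G j) d" for j
  define G' where "G' l = G l - (\<Sum>j\<le>N. Polynomial.smult (c j) (P d $$ (j, l)))" for l
  have a: "(form N (mrow P n i) (conj_row G') has_integral 0) {-1..1}"
  proof (rule Suc.IH)
    fix l k assume l: "l \<le> N" and k: "d \<le> k"
    show "Polynomial.coeff (G' l) k = 0"
    proof (cases "k = d")
      case True
      have "(\<Sum>j\<le>N. c j * Polynomial.coeff (P d $$ (j, l)) d) = (\<Sum>j\<le>N. if j = l then c l else 0)"
        by (intro sum.cong refl) (use l monic_mvop_coeff(1)[OF P] in auto)
      then show ?thesis using True l by (simp add: G'_def coeff_sum c_def)
    next
      case False
      then show ?thesis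
        using k l Suc.prems(2)[of l k] monic_mvop_coeff(2)[OF P, of _ l d k] by (simp add: G'_def coeff_sum)
    qed
  qed (use Suc.prems in simp)
  have b: "((\<lambda>x. \<Sum>j\<le>N. cnj (c j) * form N (mrow P n i) (conj_row (mrow P d j)) x) has_integral
      (\<Sum>j\<le>N. cnj (c j) * 0)) {-1..1}"
    by (intro has_integral_sum has_integral_mult_right monic_mvop_orthogonal P i) (use Suc.prems in auto)
  have "((\<lambda>x. form N (mrow P n i) (conj_row G') x
      + (\<Sum>j\<le>N. cnj (c j) * form N (mrow P n i) (conj_row (mrow P d j)) x)) has_integral 0) {-1..1}"
    using has_integral_add[OF a b] by simp
  moreover have "form N (mrow P n i) (conj_row G') x
      + (\<Sum>j\<le>N. cnj (c j) * form N (mrow P n i) (conj_row (mrow P d j)) x)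
      = form N (mrow P n i) (conj_row G) x" for x
  proof -
    have "(\<Sum>j\<le>N. cnj (c j) * form N (mrow P n i) (conj_row (mrow P d j)) x)
      = (\<Sum>j\<le>N. \<Sum>k\<le>N. \<Sum>l\<le>N. poly (P n $$ (i, k)) (of_real x) * of_real (real_weight N k l x)
           * (cnj (c j) * cnj (poly (P d $$ (j, l)) (of_real x))))"
      unfolding form_conj_row sum_distrib_left by (intro sum.cong refl) (simp only: mult_ac)
    also have "\<dots> = (\<Sum>k\<le>N. \<Sum>j\<le>N. \<Sum>l\<le>N. poly (P n $$ (i, k)) (of_real x) * of_real (real_weight N k l x)
           * (cnj (c j) * cnj (poly (P d $$ (j, l)) (of_real x))))"
      by (rule sum.swap)
    also have "\<dots> = (\<Sum>k\<le>N. \<Sum>l\<le>N. \<Sum>j\<le>N. poly (P n $$ (i, k)) (of_real x) * of_real (real_weight N k l x)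
           * (cnj (c j) * cnj (poly (P d $$ (j, l)) (of_real x))))"
      by (intro sum.cong refl sum.swap)
    also have "\<dots> = (\<Sum>k\<le>N. \<Sum>l\<le>N. poly (P n $$ (i, k)) (of_real x) * of_real (real_weight N k l x)
           * cnj (poly (\<Sum>j\<le>N. Polynomial.smult (c j) (P d $$ (j, l))) (of_real x)))"
      by (simp add: poly_sum sum_distrib_left)
    finally show ?thesis
      unfolding form_conj_row G'_def poly_diff complex_cnj_diff
      by (simp only: sum.distrib[symmetric] distrib_left[symmetric] diff_add_cancel)
  qed
  ultimately show ?case by simp
qed

text \<open>The row \<open>H = D F - \<lambda> F\<close>, with \<open>F\<close> the row \<open>i\<close> of \<open>P\<^sub>n\<close>, has degree less than \<open>n\<close>, since the leading
  terms cancel. By symmetry its pairing with its own conjugate is the pairing of \<open>F\<close> with rows of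
  degree less than \<open>n\<close>, hence zero, and the weight is definite.\<close>
lemma monic_mvop_eigen:
  assumes P: "monic_mvop N P" and i: "i \<le> N" and l: "l \<le> N"
  shows "hyp_op N g (mrow P n i) l = Polynomial.smult (of_real (hyp_eig N g n i)) (P n $$ (i, l))"
proof -
  define F where "F = mrow P n i"
  define H where "H l = hyp_op N g F l - Polynomial.smult (of_real (hyp_eig N g n i)) (F l)" for l
  define G where "G = conj_row H"
  have H: "Polynomial.coeff (H l) k = 0" if "l \<le> N" "n \<le> k" for l k
  proof -
    have z: "Polynomial.coeff (F j) m = 0" if "j \<le> N" "n < m" for j m
      unfolding F_def using monic_mvop_coeff(2)[OF P i that(1)] that by simp
    have "Polynomial.coeff (H l) k = (of_real (hyp_eig N g k l) - of_real (hyp_eig N g n i)) * Polynomial.coeff (F l) k"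
      using that by (simp add: H_def coeff_hyp_op z algebra_simps)
    also have "\<dots> = 0"
      using monic_mvop_coeff(1)[OF P i that(1), of n] z[OF that(1), of k] that(2)
      by (cases "k = n") (auto simp: F_def)
    finally show ?thesis .
  qed
  have cG: "Polynomial.coeff (G l) k = 0" if "l \<le> N" "n \<le> k" for l k
    using H[OF that] by (simp add: G_def coeff_map_poly)
  have cop: "Polynomial.coeff (conj_row (hyp_op N g G) l) k = 0" if "l \<le> N" "n \<le> k" for l k
    using that by (simp add: coeff_map_poly coeff_hyp_op cG)
  have hf: "form N H A x = form N (hyp_op N g F) A x - of_real (hyp_eig N g n i) * form N F A x" for A x
    unfolding H_def form_diff_smult ..
  have conj_conj: "conj_row (conj_row A) = A" for A
    by (simp add: fun_eq_iff map_poly_map_poly o_def)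
  have 1: "(form N F G has_integral 0) {-1..1}"
    unfolding F_def G_def by (rule monic_mvop_orthogonal_lower[OF P i order_refl H])
  have "(form N F (conj_row (conj_row (hyp_op N g G))) has_integral 0) {-1..1}"
    unfolding F_def by (rule monic_mvop_orthogonal_lower[OF P i order_refl cop])
  then have 2: "(form N F (hyp_op N g G) has_integral 0) {-1..1}" unfolding conj_conj .
  have "((\<lambda>x. (form N (hyp_op N g F) G x - form N F (hyp_op N g G) x) + form N F (hyp_op N g G) x
       + (- of_real (hyp_eig N g n i)) * form N F G x) has_integral (0 + 0 + (- of_real (hyp_eig N g n i)) * 0)) {-1..1}"
    by (intro has_integral_add has_integral_mult_right hyp_op_symmetric 1 2)
  moreover have "(form N (hyp_op N g F) G x - form N F (hyp_op N g G) x) + form N F (hyp_op N g G) x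
       + (- of_real (hyp_eig N g n i)) * form N F G x = form N H (conj_row H) x" for x
    using hf[of G x] by (simp add: G_def)
  ultimately have "(form N H (conj_row H) has_integral 0) {-1..1}" by simp
  from form_definite[OF this l] show ?thesis by (simp add: H_def F_def)
qed

section \<open>The parameter matrices\<close>
lemma mat_mult_entry:
  fixes A B :: "complex mat"
  assumes "A \<in> carrier_mat (N + 1) (N + 1)" "B \<in> carrier_mat (N + 1) (N + 1)" "i \<le> N" "j \<le> N"
  shows "(A * B) $$ (i, j) = (\<Sum>l\<le>N. A $$ (i, l) * B $$ (l, j))"
  using assms by (simp add: scalar_prod_def atLeast0LessThan lessThan_Suc_atMost)

lemma mat_vec_entry:
  fixes A :: "complex mat"
  assumes "A \<in> carrier_mat (N + 1) (N + 1)" "v \<in> carrier_vec (N + 1)" "i \<le> N"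
  shows "vec_index (A *\<^sub>v v) i = (\<Sum>l\<le>N. A $$ (i, l) * vec_index v l)"
  using assms by (simp add: scalar_prod_def atLeast0LessThan lessThan_Suc_atMost)

lemma smult_mat_vec:
  fixes A :: "complex mat"
  assumes "A \<in> carrier_mat d d" "v \<in> carrier_vec d"
  shows "(c \<cdot>\<^sub>m A) *\<^sub>v v = c \<cdot>\<^sub>v (A *\<^sub>v v)"
  using assms by (intro eq_vecI) (auto simp: scalar_prod_def sum_distrib_left mult_ac)

lemma sum_single_row:
  fixes x f :: "nat \<Rightarrow> complex"
  assumes "j \<le> N"
  shows "(\<Sum>l\<le>N. (f l + (if l = j then c else 0)) * x l) = (\<Sum>l\<le>N. f l * x l) + c * x j"
    and "(\<Sum>l\<le>N. (if l = j then c else 0) * x l) = c * x j"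
proof -
  have "(\<Sum>l\<le>N. (if l = j then c else 0) * x l) = (\<Sum>l\<le>N. if l = j then c * x j else 0)"
    by (intro sum.cong refl) auto
  then show "(\<Sum>l\<le>N. (if l = j then c else 0) * x l) = c * x j" using assms by simp
  then show "(\<Sum>l\<le>N. (f l + (if l = j then c else 0)) * x l) = (\<Sum>l\<le>N. f l * x l) + c * x j"
    by (simp only: distrib_right sum.distrib)
qed

lemma parameters_cmat:
  "C_alpha N \<alpha> = cmat N (C_entry N (\<alpha> / real N))"
  "U_alpha N \<alpha> = cmat N (\<lambda>i j. if j = i then U_entry N (\<alpha> / real N) i else 0)"
  "V_alpha N \<alpha> = cmat N (\<lambda>i j. if j = i then V_entry N (\<alpha> / real N) i else 0)"
proof -
  show "C_alpha N \<alpha> = cmat N (C_entry N (\<alpha> / real N))"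
    by (rule eq_matI; cases "N = 0")
      (auto simp: C_alpha_def C_mat_def B0_mat_def cmat_def C_entry_def of_real_mult[symmetric] of_real_add[symmetric]
        simp del: of_real_mult of_real_add intro!: arg_cong[of _ _ complex_of_real], auto simp: field_simps)
  show "U_alpha N \<alpha> = cmat N (\<lambda>i j. if j = i then U_entry N (\<alpha> / real N) i else 0)"
    by (rule eq_matI; cases "N = 0") (auto simp: U_alpha_def U_mat_def B1_mat_def cmat_def U_entry_def field_simps)
  show "V_alpha N \<alpha> = cmat N (\<lambda>i j. if j = i then V_entry N (\<alpha> / real N) i else 0)"
    by (rule eq_matI; cases "N = 0") (auto simp: V_alpha_def V_mat_def A0_mat_def cmat_def V_entry_def field_simps)
qed

lemma eigval_hyp_eig: "i \<le> N \<Longrightarrow> eigval N \<alpha> n i = hyp_eig N (\<alpha> / real N) n i"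
  by (cases "N = 0") (auto simp: eigval_def hyp_eig_def U_entry_def V_entry_def field_simps)

lemma minv_inverse:
  assumes A: "A \<in> carrier_mat d d" and "det A \<noteq> 0"
  shows "minv A \<in> carrier_mat d d" "minv A * A = 1\<^sub>m d" "A * minv A = 1\<^sub>m d"
proof -
  from det_non_zero_imp_unit[OF assms, of "()"] have "mat_inverse A \<noteq> None"
    using mat_inverse(1)[OF A, of "()"] by auto
  then obtain B where "mat_inverse A = Some B" by blast
  with mat_inverse(2)[OF A this]
  show "minv A \<in> carrier_mat d d" "minv A * A = 1\<^sub>m d" "A * minv A = 1\<^sub>m d"
    by (auto simp: minv_def)
qed

text \<open>Row \<open>i\<close> and column \<open>j\<close> of \<open>C\<^sub>\<alpha> L\<close> for the Pascal matrix \<open>L\<close>. In the representation of \<open>sl\<^sub>2\<close> on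
  polynomials of degree at most \<open>N\<close>, the matrix \<open>C\<^sub>\<alpha> - (N + 3) / 2\<close> is the image of a traceless
  \<open>2 \<times> 2\<close> matrix that has the eigenvector \<open>(1, 1)\<close> for every \<open>\<alpha>\<close>, and \<open>L\<close> is the image of a
  unipotent matrix that carries a basis vector to it. So \<open>L\<^sup>-\<^sup>1 C\<^sub>\<alpha> L\<close> is upper triangular, with the
  diagonal entries \<open>(2 j + 3) / 2\<close>.\<close>
lemma C_entry_pascal:
  assumes "i \<le> N"
  shows "(\<Sum>k\<le>N. C_entry N g i k * real (k choose j)) = (real j + 3 / 2) * real (i choose j)
     - (case j of 0 \<Rightarrow> 0 | Suc j' \<Rightarrow> (1 + g) / 2 * (real N - real j') * real (i choose j'))"
proof -
  define b where "b = real (i choose j)"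
  define b' where "b' = (case j of 0 \<Rightarrow> 0 | Suc j' \<Rightarrow> real (i choose j'))"
  have up: "real (Suc i choose j) = b + b'"
    by (cases j) (auto simp: b_def b'_def)
  have jb: "real j * b = (real i - real j + 1) * b'"
    by (cases j) (use choose_Suc_mult[of _ i] in \<open>auto simp: b_def b'_def algebra_simps\<close>)
  have down: "real i * real ((i - 1) choose j) = (real i - real j) * b"
  proof (cases "j \<le> i")
    case True
    have "real ((i - j) * (i choose j)) = real (i * ((i - 1) choose j))"
      by (simp only: binomial_absorb_comp)
    then show ?thesis using True by (simp add: b_def of_nat_diff)
  next
    case False
    then have "i choose j = 0" "(i - 1) choose j = 0" by (auto intro: binomial_eq_0)
    then show ?thesis by (simp only: b_def of_nat_0 mult_zero_right)
  qed
  have "(\<Sum>k\<le>N. C_entry N g i k * real (k choose j)) = C_entry N g i i * real (i choose j)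
      + (if i < N then C_entry N g i (Suc i) * real (Suc i choose j) else 0)
      + (case i of 0 \<Rightarrow> 0 | Suc k \<Rightarrow> C_entry N g i k * real (k choose j))"
    by (rule sum_tridiagonal[OF assms]) (auto simp: C_entry_def)
  also have "\<dots> = (real N + 3 + g * (real N - 2 * real i)) / 2 * b
      - (real N - real i) * (1 + g) / 2 * (b + b') - (1 - g) / 2 * (real i * real ((i - 1) choose j))"
    unfolding up using assms by (auto simp: C_entry_def b_def split: nat.split)
  also have "\<dots> = (real j + 3 / 2) * b - (1 + g) / 2 * ((real N - real i) * b' + real j * b)"
    unfolding down by (simp add: field_simps)
  also have "(real N - real i) * b' + real j * b = (real N - real j + 1) * b'"
    unfolding jb by (simp add: algebra_simps)
  finally show ?thesis by (simp add: b_def b'_def split: nat.split)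
qed

text \<open>The recursion that defines Tirao's coefficients can be solved, whatever the value of \<open>\<alpha>\<close>.\<close>
lemma det_C_alpha_shift: "det (transpose_mat (C_alpha N \<alpha>) + scalar_mat (N + 1) (of_nat k)) \<noteq> 0"
proof -
  define g where "g = \<alpha> / real N"
  define C where "C = C_alpha N \<alpha> + scalar_mat (N + 1) (of_nat k)"
  define L where "L = cmat N (\<lambda>i j. real (i choose j))"
  define T where "T = cmat N (\<lambda>i j. if i = j then real j + 3 / 2 + real k
     else if j = Suc i then - ((1 + g) / 2 * (real N - real i)) else 0)"
  have car: "C \<in> carrier_mat (N + 1) (N + 1)" "L \<in> carrier_mat (N + 1) (N + 1)" "T \<in> carrier_mat (N + 1) (N + 1)"
    by (auto simp: C_def L_def T_def parameters_cmat cmat_def scalar_mat_def)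
  have "C * L = L * T"
  proof (rule eq_matI)
    fix i j assume "i < dim_row (L * T)" "j < dim_col (L * T)"
    then have ij: "i \<le> N" "j \<le> N" using car by auto
    have "(C * L) $$ (i, j) = (\<Sum>l\<le>N. C $$ (i, l) * L $$ (l, j))"
      using ij car by (simp add: scalar_prod_def atLeast0LessThan lessThan_Suc_atMost)
    also have "\<dots> = (\<Sum>l\<le>N. of_real ((C_entry N g i l + (if i = l then real k else 0)) * real (l choose j)))"
      using ij by (intro sum.cong refl)
        (auto simp: C_def L_def parameters_cmat cmat_def scalar_mat_def g_def)
    also have "\<dots> = of_real (\<Sum>l\<le>N. (C_entry N g i l + (if i = l then real k else 0)) * real (l choose j))"
      by simp
    also have "(\<Sum>l\<le>N. (C_entry N g i l + (if i = l then real k else 0)) * real (l choose j))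
      = (\<Sum>l\<le>N. C_entry N g i l * real (l choose j)) + (\<Sum>l\<le>N. if i = l then real k * real (i choose j) else 0)"
      unfolding sum.distrib[symmetric] by (intro sum.cong refl) (simp add: algebra_simps)
    also have "(\<Sum>l\<le>N. if i = l then real k * real (i choose j) else 0) = real k * real (i choose j)"
      using ij by simp
    also have "(\<Sum>l\<le>N. C_entry N g i l * real (l choose j)) + real k * real (i choose j)
      = real (i choose j) * (real j + 3 / 2 + real k)
        + (case j of 0 \<Rightarrow> 0 | Suc j' \<Rightarrow> real (i choose j') * - ((1 + g) / 2 * (real N - real j')))"
      unfolding C_entry_pascal[OF ij(1)] by (simp add: algebra_simps split: nat.split)
    also have "\<dots> = (\<Sum>l\<le>N. real (i choose l) * (if l = j then real j + 3 / 2 + real k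
        else if j = Suc l then - ((1 + g) / 2 * (real N - real l)) else 0))"
      by (subst sum_tridiagonal[OF ij(2)]) (auto split: nat.split)
    also have "complex_of_real \<dots> = (\<Sum>l\<le>N. L $$ (i, l) * T $$ (l, j))"
      unfolding of_real_sum using ij
      by (intro sum.cong refl) (auto simp: L_def T_def cmat_def)
    also have "\<dots> = (L * T) $$ (i, j)"
      using ij car by (simp add: scalar_prod_def atLeast0LessThan lessThan_Suc_atMost)
    finally show "(C * L) $$ (i, j) = (L * T) $$ (i, j)" .
  qed (use car in auto)
  then have "det C * det L = det L * det T"
    by (simp only: det_mult[OF car(1,2), symmetric] det_mult[OF car(2,3), symmetric])
  moreover have "det L = prod_list (diag_mat L)"
    by (rule det_lower_triangular[OF _ car(2)]) (auto simp: L_def cmat_def)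
  moreover have "det T = prod_list (diag_mat T)"
    by (rule det_upper_triangular[OF _ car(3)]) (auto simp: T_def cmat_def)
  moreover have "prod_list (diag_mat L) \<noteq> 0"
    by (auto simp: prod_list_zero_iff diag_mat_def L_def cmat_def)
  moreover have "prod_list (diag_mat T) \<noteq> 0"
  proof -
    have "complex_of_real (real i + 3 / 2 + real k) \<noteq> 0" for i
      by (simp only: of_real_eq_0_iff)
    then show ?thesis by (auto simp: prod_list_zero_iff diag_mat_def T_def cmat_def simp del: of_real_add of_real_divide)
  qed
  ultimately have "det C \<noteq> 0" by auto
  moreover have "transpose_mat (C_alpha N \<alpha>) + scalar_mat (N + 1) (of_nat k) = transpose_mat C"
    by (rule eq_matI) (auto simp: C_def parameters_cmat cmat_def scalar_mat_def)
  ultimately show ?thesis using det_transpose[OF car(1)] by simp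
qed

section \<open>Convergence of the hypergeometric series\<close>
text \<open>Here \<open>a k\<close> is a column of the \<open>k\<close>-th term of the series. The norm of \<open>a (k + 1)\<close> is estimated without
  inverting \<open>C + k\<close>: for the \<open>l\<^sup>1\<close> norm \<open>s k\<close> of \<open>a k\<close> the recursion gives
  \<open>(k - b) * s (k + 1) \<le> \<bar>u\<bar> * (k\<^sup>2 + c k + c) / (k + 1) * s k\<close> with \<open>b\<close> the sum of the moduli of the
  entries of \<open>A\<close>. The ratio of the two factors tends to \<open>\<bar>u\<bar> < 1\<close>.\<close>
lemma summable_of_recursion:
  fixes a :: "nat \<Rightarrow> nat \<Rightarrow> complex" and A :: "nat \<Rightarrow> nat \<Rightarrow> complex" and c :: real
  assumes rec: "\<And>k j. j \<le> N \<Longrightarrow> of_nat k * a (Suc k) j + (\<Sum>l\<le>N. A j l * a (Suc k) l)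
      = u * \<mu> k j / of_nat (Suc k) * a k j"
    and \<mu>: "\<And>k j. j \<le> N \<Longrightarrow> cmod (\<mu> k j) \<le> (real k)\<^sup>2 + c * real k + c"
    and u: "cmod u < 1" and j: "j \<le> N"
  shows "summable (\<lambda>k. a k j)"
proof -
  define s where "s k = (\<Sum>j\<le>N. cmod (a k j))" for k
  define b where "b = (\<Sum>j\<le>N. \<Sum>l\<le>N. cmod (A j l))"
  define q where "q k = cmod u * (((real k)\<^sup>2 + c * real k + c) / (real k + 1))" for k
  have s0: "s k \<ge> 0" for k by (simp add: s_def sum_nonneg)
  have as: "cmod (a k l) \<le> s k" if "l \<le> N" for k l
    unfolding s_def using that by (intro member_le_sum) auto
  have step: "(real k - b) * s (Suc k) \<le> q k * s k" for k
  proof -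
    have "real k * cmod (a (Suc k) j) \<le> q k * cmod (a k j) + (\<Sum>l\<le>N. cmod (A j l)) * s (Suc k)" if j: "j \<le> N" for j
    proof -
      have "real k * cmod (a (Suc k) j) = cmod (u * \<mu> k j / of_nat (Suc k) * a k j - (\<Sum>l\<le>N. A j l * a (Suc k) l))"
        unfolding rec[OF j, symmetric] by (simp add: norm_mult)
      also have "\<dots> \<le> cmod (u * \<mu> k j / of_nat (Suc k) * a k j) + cmod (\<Sum>l\<le>N. A j l * a (Suc k) l)"
        by (rule norm_triangle_ineq4)
      also have "cmod (u * \<mu> k j / of_nat (Suc k) * a k j) = cmod u * (cmod (\<mu> k j) / (real k + 1)) * cmod (a k j)"
        by (simp add: norm_mult norm_divide add.commute del: of_nat_Suc)
      also have "\<dots> \<le> q k * cmod (a k j)"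
        unfolding q_def by (intro mult_right_mono mult_left_mono divide_right_mono \<mu> j) auto
      also have "cmod (\<Sum>l\<le>N. A j l * a (Suc k) l) \<le> (\<Sum>l\<le>N. cmod (A j l) * s (Suc k))"
        by (rule sum_norm_le) (auto simp: norm_mult intro!: mult_left_mono as)
      finally show ?thesis by (simp add: sum_distrib_right)
    qed
    then have "(\<Sum>j\<le>N. real k * cmod (a (Suc k) j))
        \<le> (\<Sum>j\<le>N. q k * cmod (a k j) + (\<Sum>l\<le>N. cmod (A j l)) * s (Suc k))"
      by (intro sum_mono) auto
    then show ?thesis
      by (simp add: s_def b_def sum.distrib sum_distrib_left[symmetric] sum_distrib_right[symmetric] algebra_simps)
  qed
  obtain \<rho> where \<rho>: "cmod u < \<rho>" "\<rho> < 1" using u dense by blast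
  have "((\<lambda>k::nat. ((real k)\<^sup>2 + c * real k + c) / (real k + 1) / (real k - b)) \<longlongrightarrow> 1) at_top"
  proof (rule Lim_transform_eventually)
    have "((\<lambda>k::nat. (1 + c * inverse (real k) + c * inverse (real k) * inverse (real k))
        / (1 + inverse (real k)) / (1 - b * inverse (real k))) \<longlongrightarrow> (1 + c * 0 + c * 0 * 0) / (1 + 0) / (1 - b * 0)) at_top"
      by (intro tendsto_intros lim_inverse_n) auto
    then show "((\<lambda>k::nat. (1 + c * inverse (real k) + c * inverse (real k) * inverse (real k))
        / (1 + inverse (real k)) / (1 - b * inverse (real k))) \<longlongrightarrow> 1) at_top"
      by simp
    show "eventually (\<lambda>k. (1 + c * inverse (real k) + c * inverse (real k) * inverse (real k))
        / (1 + inverse (real k)) / (1 - b * inverse (real k))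
        = ((real k)\<^sup>2 + c * real k + c) / (real k + 1) / (real k - b)) at_top"
      using eventually_gt_at_top[of 0]
    proof eventually_elim
      case (elim k)
      define r where "r = real k"
      have r: "r \<noteq> 0" using elim by (simp add: r_def)
      have "1 + c * inverse r + c * inverse r * inverse r = (r\<^sup>2 + c * r + c) / (r * r)"
        "1 + inverse r = (r + 1) / r" "1 - b * inverse r = (r - b) / r"
        using r by (simp_all add: field_simps power2_eq_square)
      then show ?case unfolding r_def[symmetric] using r by simp
    qed
  qed
  then have "((\<lambda>k::nat. cmod u * (((real k)\<^sup>2 + c * real k + c) / (real k + 1) / (real k - b))) \<longlongrightarrow> cmod u * 1) at_top"
    by (rule tendsto_mult_left)
  then have "eventually (\<lambda>k. cmod u * (((real k)\<^sup>2 + c * real k + c) / (real k + 1) / (real k - b)) < \<rho>) at_top"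
    using \<rho>(1) by (intro order_tendstoD(2)) auto
  moreover have "eventually (\<lambda>k. real k > b) at_top"
    using filterlim_real_sequentially by (simp add: filterlim_at_top_dense)
  ultimately have "eventually (\<lambda>k. s (Suc k) \<le> \<rho> * s k) at_top"
  proof eventually_elim
    case (elim k)
    have "s (Suc k) \<le> q k / (real k - b) * s k"
      using step[of k] elim(2) by (simp add: field_simps)
    also have "\<dots> \<le> \<rho> * s k"
      using elim(1) by (intro mult_right_mono s0) (simp add: q_def)
    finally show ?case .
  qed
  then obtain K where K: "\<And>k. k \<ge> K \<Longrightarrow> s (Suc k) \<le> \<rho> * s k"
    by (auto simp: eventually_at_top_linorder)
  have "summable s"
    by (rule summable_ratio_test[of \<rho> K]) (use \<rho> K s0 in auto)
  then show ?thesis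
    by (rule summable_comparison_test'[where N = 0]) (use as j in auto)
qed

section \<open>Power series coefficients at the singular point\<close>
lemma pcompose_affine_coeff:
  fixes p :: "complex poly"
  assumes "degree p \<le> n" "b \<noteq> 0"
  shows "Polynomial.coeff (pcompose p [:a, b:]) n = b ^ n * Polynomial.coeff p n"
proof (cases "degree p = n")
  case True
  have "degree (pcompose p [:a, b:]) = n" using True assms(2) by (simp add: degree_pcompose)
  then show ?thesis using lead_coeff_comp[of "[:a, b:]" p] True assms(2) by simp
next
  case False
  then have "degree (pcompose p [:a, b:]) < n" "degree p < n"
    using assms by (simp_all add: degree_pcompose)
  then show ?thesis by (simp add: coeff_eq_0)
qed

text \<open>The eigenvalue equation in the variable \<open>u = (1 - x) / 2\<close>, read off at \<open>u\<^sup>k\<close>. For column vectors it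
  says \<open>(k + 1) (C\<^sup>t + k) p\<^sub>k\<^sub>+\<^sub>1 = (k\<^sup>2 + k (U\<^sup>t - 1) + V\<^sup>t + \<mu>) p\<^sub>k\<close>, which is Tirao's recursion.\<close>
lemma eigen_row_recursion:
  fixes F :: "nat \<Rightarrow> complex poly" and c :: complex
  assumes "\<And>l. l \<le> N \<Longrightarrow> hyp_op N g F l = Polynomial.smult \<mu> (F l)" and l: "l \<le> N"
  defines "p \<equiv> \<lambda>F l. Polynomial.smult c (pcompose (F l) [:1, -2:])"
  shows "of_nat (Suc k) * (of_nat k * Polynomial.coeff (p F l) (Suc k)
      + (\<Sum>m\<le>N. of_real (C_entry N g m l) * Polynomial.coeff (p F m) (Suc k)))
    = ((of_nat k)\<^sup>2 + of_nat k * (of_real (U_entry N g l) - 1) + of_real (V_entry N g l) + \<mu>) * Polynomial.coeff (p F l) k"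
proof -
  define Q :: "complex poly" where "Q = [:1, -2:]"
  have p: "p F l = Polynomial.smult c (pcompose (F l) Q)" for l by (simp add: p_def Q_def)
  have d1: "pcompose (pderiv q) Q = Polynomial.smult (- 1 / 2) (pderiv (pcompose q Q))" for q
    by (simp add: pderiv_pcompose Q_def pderiv_pCons mult.commute)
  have d2: "pcompose (pderiv (pderiv q)) Q = Polynomial.smult (1 / 4) (pderiv (pderiv (pcompose q Q)))" for q
    unfolding d1 pderiv_smult smult_smult by simp
  have a: "pcompose [:1, 0, -1:] Q = [:0, 4, -4:]"
    by (simp add: Q_def pcompose_pCons)
  have b: "pcompose (drift_poly N g m l) Q = [: - 2 * of_real (C_entry N g m l), of_real (if m = l then 2 * U_entry N g m else 0) :]" for m
    by (simp add: Q_def drift_poly_def pcompose_pCons)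
  have "pcompose (hyp_op N g F l) Q = Polynomial.smult \<mu> (pcompose (F l) Q)"
    using assms(1)[OF l] by (simp add: pcompose_smult)
  then have "Polynomial.smult c (pcompose (hyp_op N g F l) Q) = Polynomial.smult \<mu> (p F l)"
    by (simp add: p_def Q_def mult.commute)
  moreover have "Polynomial.smult c (pcompose (hyp_op N g F l) Q)
     = [:0, 1, -1:] * pderiv (pderiv (p F l))
       + (\<Sum>m\<le>N. [: of_real (C_entry N g m l), - of_real (if m = l then U_entry N g m else 0) :] * pderiv (p F m))
       - Polynomial.smult (of_real (V_entry N g l)) (p F l)"
  proof -
    have scale: "Polynomial.smult c (Polynomial.smult a A * Polynomial.smult b q) = Polynomial.smult (a * b) (A * Polynomial.smult c q)"
      for a b A q by (simp add: mult_ac)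
    have "[:0, 4, -4:] = Polynomial.smult (4 :: complex) [:0, 1, -1:]" by simp
    then have 1: "Polynomial.smult c ([:0, 4, -4:] * Polynomial.smult (1 / 4) q) = [:0, 1, -1:] * Polynomial.smult c q" for q
      by (simp only: scale) simp
    have "[: - 2 * x, of_real (if m = l then 2 * y else 0) :]
        = Polynomial.smult (- 2 :: complex) [: x, - of_real (if m = l then y else 0) :]" for x y m by simp
    then have 2: "Polynomial.smult c ([: - 2 * x, of_real (if m = l then 2 * y else 0) :] * Polynomial.smult (- 1 / 2) q)
      = [: x, - of_real (if m = l then y else 0) :] * Polynomial.smult c q" for q x y m
      by (simp only: scale) simp
    show ?thesis
      unfolding hyp_op_def pcompose_add pcompose_diff pcompose_mult pcompose_sum pcompose_smult d2 a b
      unfolding d1 smult_add_right smult_diff_right smult_sum2 1 2 p pderiv_smult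
      by (simp only: smult_smult mult.commute)
  qed
  ultimately have eq: "[:0, 1, -1:] * pderiv (pderiv (p F l))
       + (\<Sum>m\<le>N. [: of_real (C_entry N g m l), - of_real (if m = l then U_entry N g m else 0) :] * pderiv (p F m))
       - Polynomial.smult (of_real (V_entry N g l)) (p F l) = Polynomial.smult \<mu> (p F l)"
    by simp
  have quad: "Polynomial.coeff ([:0, 1, -1:] * pderiv (pderiv q)) k
    = of_nat (Suc k) * of_nat k * Polynomial.coeff q (Suc k) - of_nat k * (of_nat k - 1) * Polynomial.coeff q k"
    for q :: "complex poly"
  proof -
    consider "k = 0" | "k = 1" | m where "k = m + 2"
      by (metis One_nat_def add_2_eq_Suc' not0_implies_Suc)
    then show ?thesis by cases (auto simp: coeff_pderiv algebra_simps numeral_2_eq_2)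
  qed
  have lin: "Polynomial.coeff ([:x, y:] * pderiv q) k = x * (of_nat (Suc k) * Polynomial.coeff q (Suc k))
      + y * (of_nat k * Polynomial.coeff q k)" for x y :: complex and q
    by (cases k) (auto simp: coeff_pderiv algebra_simps)
  have "(\<Sum>m\<le>N. Polynomial.coeff ([: of_real (C_entry N g m l), - of_real (if m = l then U_entry N g m else 0) :] * pderiv (p F m)) k)
    = of_nat (Suc k) * (\<Sum>m\<le>N. of_real (C_entry N g m l) * Polynomial.coeff (p F m) (Suc k))
      + (\<Sum>m\<le>N. if m = l then - of_real (U_entry N g l) * (of_nat k * Polynomial.coeff (p F l) k) else 0)"
    unfolding lin sum.distrib sum_distrib_left
    by (intro arg_cong2[of _ _ _ _ "(+)"] sum.cong refl) auto
  also have "(\<Sum>m\<le>N. if m = l then - of_real (U_entry N g l) * (of_nat k * Polynomial.coeff (p F l) k) else 0)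
     = - of_real (U_entry N g l) * (of_nat k * Polynomial.coeff (p F l) k)"
    using l by simp
  finally have S: "(\<Sum>m\<le>N. Polynomial.coeff ([: of_real (C_entry N g m l), - of_real (if m = l then U_entry N g m else 0) :] * pderiv (p F m)) k)
    = of_nat (Suc k) * (\<Sum>m\<le>N. of_real (C_entry N g m l) * Polynomial.coeff (p F m) (Suc k))
      + - of_real (U_entry N g l) * (of_nat k * Polynomial.coeff (p F l) k)" .
  show ?thesis
    using arg_cong[OF eq, of "\<lambda>q. Polynomial.coeff q k"]
    unfolding coeff_diff coeff_add coeff_sum quad coeff_smult S
    by (simp add: algebra_simps power2_eq_square)
qed

section \<open>The coefficients of the hypergeometric function\<close>
abbreviation (input) Ct :: "nat \<Rightarrow> real \<Rightarrow> complex mat" where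
  "Ct N \<alpha> \<equiv> transpose_mat (C_alpha N \<alpha>)"

abbreviation (input) bracket :: "nat \<Rightarrow> real \<Rightarrow> nat \<Rightarrow> nat \<Rightarrow> nat \<Rightarrow> complex mat" where
  "bracket N \<alpha> n i k \<equiv> tirao_coeff (Ct N \<alpha>) (transpose_mat (U_alpha N \<alpha>)) (V_shift N \<alpha> n i) k"

definition C_shift :: "nat \<Rightarrow> real \<Rightarrow> nat \<Rightarrow> complex mat" where
  "C_shift N \<alpha> k = Ct N \<alpha> + scalar_mat (N + 1) (of_nat k)"

definition diag_step :: "nat \<Rightarrow> real \<Rightarrow> nat \<Rightarrow> nat \<Rightarrow> nat \<Rightarrow> complex mat" where
  "diag_step N \<alpha> n i k = mat (N + 1) (N + 1) (\<lambda>(j, l). if j = l then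
     of_real (hyp_eig N (\<alpha> / real N) n i - hyp_eig N (\<alpha> / real N) k j) else 0)"

lemma Ct_carrier: "Ct N \<alpha> \<in> carrier_mat (N + 1) (N + 1)" "dim_row (Ct N \<alpha>) = N + 1"
  by (simp_all add: parameters_cmat cmat_def)

text \<open>The numerators of Tirao's recursion are diagonal, and their entries are differences of
  eigenvalues, since \<open>- \<lambda>\<^sub>k\<^sup>\<alpha>(j) = k\<^sup>2 + k (U\<^sub>j - 1) + V\<^sub>j\<close>. So a bracket is invertible unless
  \<open>\<lambda>\<^sub>n\<^sup>\<alpha>(i)\<close> coincides with an eigenvalue of lower degree.\<close>
lemma tirao_factor:
  assumes "i \<le> N"
  shows "scalar_mat (N + 1) (of_nat k ^ 2) + of_nat k \<cdot>\<^sub>m (transpose_mat (U_alpha N \<alpha>) - 1\<^sub>m (N + 1))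
     + V_shift N \<alpha> n i = diag_step N \<alpha> n i k"
  by (rule eq_matI)
    (auto simp: diag_step_def scalar_mat_def V_shift_def parameters_cmat cmat_def eigval_hyp_eig[OF assms] hyp_eig_def
      power2_eq_square algebra_simps)

lemma bracket_step:
  assumes "i \<le> N"
  shows "bracket N \<alpha> n i (Suc k) = minv (C_shift N \<alpha> k) * diag_step N \<alpha> n i k * bracket N \<alpha> n i k"
  unfolding tirao_coeff.simps Ct_carrier(2) C_shift_def tirao_factor[OF assms] ..

lemma C_shift_carrier: "C_shift N \<alpha> k \<in> carrier_mat (N + 1) (N + 1)"
  by (simp add: C_shift_def parameters_cmat cmat_def scalar_mat_def)

lemma C_shift_entry:
  assumes "j \<le> N" "l \<le> N"
  shows "C_shift N \<alpha> k $$ (j, l)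
    = of_real (C_entry N (\<alpha> / real N) l j) + (if l = j then of_nat k else 0)"
  using assms by (auto simp: C_shift_def parameters_cmat cmat_def scalar_mat_def)

lemma diag_step_entry:
  assumes "j \<le> N" "l \<le> N"
  shows "diag_step N \<alpha> n i k $$ (j, l)
    = (if l = j then of_real (hyp_eig N (\<alpha> / real N) n i - hyp_eig N (\<alpha> / real N) k j) else 0)"
  using assms by (auto simp: diag_step_def)

lemmas C_shift_inverse = minv_inverse[OF C_shift_carrier det_C_alpha_shift[folded C_shift_def]]

lemma diag_step_carrier: "diag_step N \<alpha> n i k \<in> carrier_mat (N + 1) (N + 1)"
  by (simp add: diag_step_def)

lemma bracket_carrier: "i \<le> N \<Longrightarrow> bracket N \<alpha> n i k \<in> carrier_mat (N + 1) (N + 1)"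
proof (induction k)
  case 0
  then show ?case by (simp add: parameters_cmat cmat_def)
next
  case (Suc k)
  then show ?case unfolding bracket_step[OF Suc.prems]
    by (intro mult_carrier_mat[of _ _ "N + 1"] C_shift_inverse diag_step_carrier) auto
qed

lemma bracket_rec:
  assumes "i \<le> N"
  shows "C_shift N \<alpha> k * bracket N \<alpha> n i (Suc k) = diag_step N \<alpha> n i k * bracket N \<alpha> n i k"
proof -
  note c = C_shift_carrier[of N \<alpha> k] C_shift_inverse(1)[of N \<alpha> k] diag_step_carrier[of N \<alpha> n i k] bracket_carrier[OF assms, of \<alpha> n k]
  have "C_shift N \<alpha> k * bracket N \<alpha> n i (Suc k)
    = C_shift N \<alpha> k * minv (C_shift N \<alpha> k)
      * (diag_step N \<alpha> n i k * bracket N \<alpha> n i k)"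
    unfolding bracket_step[OF assms] assoc_mult_mat[OF c(2,3,4)]
    by (rule assoc_mult_mat[symmetric, OF c(1,2) mult_carrier_mat[OF c(3,4)]])
  also have "\<dots> = diag_step N \<alpha> n i k * bracket N \<alpha> n i k"
    unfolding C_shift_inverse(3) by (rule left_mult_one_mat[OF mult_carrier_mat[OF c(3,4)]])
  finally show ?thesis .
qed

lemma det_bracket:
  assumes "i \<le> N" and "\<And>m j. m < k \<Longrightarrow> j \<le> N \<Longrightarrow> hyp_eig N (\<alpha> / real N) n i \<noteq> hyp_eig N (\<alpha> / real N) m j"
  shows "det (bracket N \<alpha> n i k) \<noteq> 0"
  using assms(2)
proof (induction k)
  case 0
  show ?case by (simp add: Ct_carrier)
next
  case (Suc k)
  have "det (diag_step N \<alpha> n i k) = prod_list (diag_mat (diag_step N \<alpha> n i k))"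
    by (rule det_upper_triangular[OF _ diag_step_carrier]) (auto simp: diag_step_def)
  also have "\<dots> \<noteq> 0"
  proof
    assume "prod_list (diag_mat (diag_step N \<alpha> n i k)) = 0"
    then have "0 \<in> set (diag_mat (diag_step N \<alpha> n i k))" by (simp only: prod_list_zero_iff)
    then obtain j where "j < dim_row (diag_step N \<alpha> n i k)" "diag_step N \<alpha> n i k $$ (j, j) = 0"
      by (auto simp: diag_mat_def)
    then have j: "j < N + 1" "diag_step N \<alpha> n i k $$ (j, j) = 0"
      using diag_step_carrier[of N \<alpha> n i k] by simp_all
    then have "complex_of_real (hyp_eig N (\<alpha> / real N) n i - hyp_eig N (\<alpha> / real N) k j) = 0"
      by (simp add: diag_step_def del: of_real_diff)
    then show False using Suc.prems[of k j] j(1) by (simp only: of_real_eq_0_iff) simp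
  qed
  finally have "det (diag_step N \<alpha> n i k * bracket N \<alpha> n i k) \<noteq> 0"
    using Suc by (simp add: det_mult[OF diag_step_carrier bracket_carrier[OF assms(1)]])
  then show ?case
    unfolding bracket_rec[OF assms(1), symmetric] det_mult[OF C_shift_carrier bracket_carrier[OF assms(1)]] by simp
qed

text \<open>The two equations between constant terms and slopes in \<open>\<alpha>\<close> combine to the equality of the squares
  of \<open>n + 1 + i\<close> and of \<open>n + 1 + N - i\<close>. Both numbers are positive and \<open>2 n + N + 2\<close> is their sum.\<close>
lemma hyp_eig_coincide:
  assumes "hyp_eig N 0 n i = hyp_eig N 0 k j" "hyp_eig N 1 n i = hyp_eig N 1 k j" "i \<le> N" "j \<le> N"
  shows "n = k"
proof -
  have "(real n + 1 + real i)\<^sup>2 = (real k + 1 + real j)\<^sup>2"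
    "(real n + 1 + (real N - real i))\<^sup>2 = (real k + 1 + (real N - real j))\<^sup>2"
    using assms(1,2) by (simp_all add: hyp_eig_def U_entry_def V_entry_def power2_eq_square algebra_simps)
  then have "real n + 1 + real i = real k + 1 + real j"
    "real n + 1 + (real N - real i) = real k + 1 + (real N - real j)"
    using assms(3,4) by (auto dest!: power2_eq_imp_eq)
  then show ?thesis by simp
qed

lemma hyp_eig_affine: "hyp_eig N g n i = hyp_eig N 0 n i + g * (hyp_eig N 1 n i - hyp_eig N 0 n i)"
  by (simp add: hyp_eig_def U_entry_def V_entry_def algebra_simps)

text \<open>A coincidence of eigenvalues is an affine equation for \<open>\<beta>\<close>, and by \<open>hyp_eig_coincide\<close> it is not
  trivial. For \<open>N = 0\<close> it does not depend on \<open>\<beta>\<close> and has no solution.\<close>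
lemma finite_resonances:
  assumes "i \<le> N"
  shows "finite {\<beta>. \<exists>k<n. \<exists>j\<le>N. hyp_eig N (\<beta> / real N) n i = hyp_eig N (\<beta> / real N) k j}"
proof -
  have "finite {\<beta>. hyp_eig N (\<beta> / real N) n i = hyp_eig N (\<beta> / real N) k j}" if k: "k < n" and j: "j \<le> N" for k j
  proof (rule finite_subset)
    define p q where "p = hyp_eig N 0 n i - hyp_eig N 0 k j"
      and "q = (hyp_eig N 1 n i - hyp_eig N 0 n i) - (hyp_eig N 1 k j - hyp_eig N 0 k j)"
    have ne: "p \<noteq> 0 \<or> q \<noteq> 0"
      using hyp_eig_coincide[OF _ _ assms j, of n k] k by (auto simp: p_def q_def)
    have N0: "p \<noteq> 0" if "N = 0"
      using that ne assms j by (auto simp: p_def q_def hyp_eig_def U_entry_def V_entry_def)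
    show "{\<beta>. hyp_eig N (\<beta> / real N) n i = hyp_eig N (\<beta> / real N) k j} \<subseteq> {- p * real N / q}"
    proof
      fix \<beta> assume "\<beta> \<in> {\<beta>. hyp_eig N (\<beta> / real N) n i = hyp_eig N (\<beta> / real N) k j}"
      then have "p + \<beta> / real N * q = 0"
        using hyp_eig_affine[of N "\<beta> / real N" n i] hyp_eig_affine[of N "\<beta> / real N" k j]
        by (simp add: p_def q_def algebra_simps)
      then show "\<beta> \<in> {- p * real N / q}"
        using ne N0 by (cases "N = 0"; cases "q = 0") (auto simp: field_simps)
    qed
  qed simp
  then have "finite (\<Union>k<n. \<Union>j\<le>N. {\<beta>. hyp_eig N (\<beta> / real N) n i = hyp_eig N (\<beta> / real N) k j})"
    by blast
  then show ?thesis by (rule finite_subset[rotated]) auto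
qed

lemma eventually_nonresonant:
  assumes "i \<le> N"
  shows "eventually (\<lambda>\<beta>. invertible_mat (bracket_n N \<beta> n i)) (at \<alpha>)"
proof -
  define S where "S = {\<beta>. \<exists>k<n. \<exists>j\<le>N. hyp_eig N (\<beta> / real N) n i = hyp_eig N (\<beta> / real N) k j}"
  have "open (- (S - {\<alpha>}))"
    using finite_resonances[OF assms, of n] unfolding S_def by (intro open_Compl finite_imp_closed) auto
  moreover have "invertible_mat (bracket_n N \<beta> n i)" if "\<beta> \<notin> S" for \<beta>
  proof -
    have "det (bracket N \<beta> n i n) \<noteq> 0"
      using that by (intro det_bracket assms) (auto simp: S_def)
    from minv_inverse[OF bracket_carrier[OF assms] this] show ?thesis
      using bracket_carrier[OF assms, of \<beta> n n]
      by (auto simp: bracket_n_def invertible_mat_def inverts_mat_def square_mat.simps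
          intro!: exI[of _ "minv (bracket N \<beta> n i n)"])
  qed
  ultimately show ?thesis
    unfolding eventually_at_topological by (intro exI[of _ "- (S - {\<alpha>})"]) auto
qed

lemma bracket_summable:
  assumes i: "i \<le> N" and "norm u < 1" "j \<le> N" "m \<le> N"
  shows "summable (\<lambda>k. u ^ k / fact k * bracket N \<alpha> n i k $$ (j, m))"
proof -
  define g where "g = \<alpha> / real N"
  define c where "c = (\<Sum>j\<le>N. \<bar>U_entry N g j - 1\<bar> + \<bar>hyp_eig N g n i + V_entry N g j\<bar>)"
  define T where "T k = bracket N \<alpha> n i k" for k
  define a where "a k j = u ^ k / fact k * T k $$ (j, m)" for k j
  have T: "T k \<in> carrier_mat (N + 1) (N + 1)" for k unfolding T_def by (rule bracket_carrier[OF i])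
  have "summable (\<lambda>k. a k j)"
  proof (rule summable_of_recursion[where u = u and c = c and N = N
        and \<mu> = "\<lambda>k j. of_real (hyp_eig N g n i - hyp_eig N g k j)" and A = "\<lambda>j l. of_real (C_entry N g l j)"])
    fix k j assume j: "j \<le> N"
    have "(\<Sum>l\<le>N. C_shift N \<alpha> k $$ (j, l) * T (Suc k) $$ (l, m))
      = (\<Sum>l\<le>N. diag_step N \<alpha> n i k $$ (j, l) * T k $$ (l, m))"
      unfolding mat_mult_entry[OF C_shift_carrier T j assms(4), symmetric]
        mat_mult_entry[OF diag_step_carrier T j assms(4), symmetric] unfolding T_def bracket_rec[OF i] ..
    then have "(\<Sum>l\<le>N. (of_real (C_entry N g l j) + (if l = j then of_nat k else 0)) * T (Suc k) $$ (l, m))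
      = (\<Sum>l\<le>N. (if l = j then of_real (hyp_eig N g n i - hyp_eig N g k j) else 0) * T k $$ (l, m))"
      using j unfolding g_def by (simp add: C_shift_entry diag_step_entry)
    then have *: "of_nat k * T (Suc k) $$ (j, m) + (\<Sum>l\<le>N. of_real (C_entry N g l j) * T (Suc k) $$ (l, m))
      = of_real (hyp_eig N g n i - hyp_eig N g k j) * T k $$ (j, m)"
      unfolding sum_single_row[OF j] by (simp only: add.commute)
    have "of_nat k * a (Suc k) j + (\<Sum>l\<le>N. of_real (C_entry N g l j) * a (Suc k) l)
      = u ^ Suc k / fact (Suc k) * (of_nat k * T (Suc k) $$ (j, m)
        + (\<Sum>l\<le>N. of_real (C_entry N g l j) * T (Suc k) $$ (l, m)))"
      unfolding a_def distrib_left sum_distrib_left by (simp only: mult_ac)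
    also have "\<dots> = u * of_real (hyp_eig N g n i - hyp_eig N g k j) / of_nat (Suc k) * a k j"
      unfolding * a_def fact_Suc by (simp add: field_simps del: of_nat_Suc)
    finally show "of_nat k * a (Suc k) j + (\<Sum>l\<le>N. of_real (C_entry N g l j) * a (Suc k) l)
      = u * of_real (hyp_eig N g n i - hyp_eig N g k j) / of_nat (Suc k) * a k j" .
    have "\<bar>U_entry N g j - 1\<bar> + \<bar>hyp_eig N g n i + V_entry N g j\<bar> \<le> c"
      unfolding c_def using j by (intro member_le_sum) auto
    then have le: "\<bar>U_entry N g j - 1\<bar> \<le> c" "\<bar>hyp_eig N g n i + V_entry N g j\<bar> \<le> c" by linarith+
    have "\<bar>hyp_eig N g n i - hyp_eig N g k j\<bar> = \<bar>(real k)\<^sup>2 + real k * (U_entry N g j - 1) + (hyp_eig N g n i + V_entry N g j)\<bar>"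
      by (simp add: hyp_eig_def[of N g k j] power2_eq_square algebra_simps)
    also have "\<dots> \<le> \<bar>(real k)\<^sup>2 + real k * (U_entry N g j - 1)\<bar> + \<bar>hyp_eig N g n i + V_entry N g j\<bar>"
      by (rule abs_triangle_ineq)
    also have "\<bar>(real k)\<^sup>2 + real k * (U_entry N g j - 1)\<bar> \<le> \<bar>(real k)\<^sup>2\<bar> + \<bar>real k * (U_entry N g j - 1)\<bar>"
      by (rule abs_triangle_ineq)
    also have "\<dots> = (real k)\<^sup>2 + real k * \<bar>U_entry N g j - 1\<bar>"
      by (simp add: abs_mult)
    also have "real k * \<bar>U_entry N g j - 1\<bar> \<le> c * real k"
      using mult_right_mono[OF le(1), of "real k"] by (simp add: mult.commute)
    also note le(2)
    finally show "cmod (of_real (hyp_eig N g n i - hyp_eig N g k j)) \<le> (real k)\<^sup>2 + c * real k + c"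
      unfolding norm_of_real by simp
  qed (use assms in auto)
  then show ?thesis by (simp add: a_def T_def)
qed

section \<open>The hypergeometric expression\<close>
text \<open>The coefficients of the row \<open>R\<^sub>n\<close> are the brackets applied to its value at \<open>u = 0\<close>. The coefficient at
  \<open>u\<^sup>n\<close> is the unit vector \<open>e\<^sub>i\<close>, as \<open>R\<^sub>n\<close> is monic, and this determines the value at \<open>0\<close> if the
  \<open>n\<close>-th bracket is invertible.\<close>
lemma R_poly_eq_hyp_vec:
  assumes P: "monic_mvop N P" and i: "i \<le> N" and j: "j \<le> N" and u: "norm u < 1"
    and inv: "invertible_mat (bracket_n N \<alpha> n i)"
  shows "R_poly P n u $$ (i, j) = vec_index (hyp_vec N \<alpha> n i u) j"
proof -
  define g where "g = \<alpha> / real N"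
  define p where "p l = Polynomial.smult ((- 1 / 2) ^ n) (pcompose (P n $$ (i, l)) [:1, -2:])" for l
  define v where "v k = vec (N + 1) (\<lambda>l. Polynomial.coeff (p l) k)" for k
  define T where "T k = bracket N \<alpha> n i k" for k
  have T: "T k \<in> carrier_mat (N + 1) (N + 1)" for k unfolding T_def by (rule bracket_carrier[OF i])
  have v: "v k \<in> carrier_vec (N + 1)" for k by (simp add: v_def)
  have R: "R_poly P n u $$ (i, j) = poly (p j) u"
  proof -
    have "P n \<in> carrier_mat (N + 1) (N + 1)"
      using P by (auto simp: monic_mvop_def monic_mat_poly_def)
    moreover have "(- 1 / 2 :: complex) ^ n = (- 1) ^ n / 2 ^ n" by (rule power_divide)
    ultimately show ?thesis
      using i j by (simp add: R_poly_def eval_mat_def p_def poly_pcompose mult.commute)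
  qed
  have deg: "degree (P n $$ (i, l)) \<le> n" if "l \<le> N" for l
    using P i that by (auto simp: monic_mvop_def monic_mat_poly_def)
  have p_deg: "Polynomial.coeff (p l) k = 0" if "l \<le> N" "n < k" for l k
    using deg[OF that(1)] that(2) by (simp add: p_def coeff_eq_0 degree_pcompose)
  have p_lead: "Polynomial.coeff (p l) n = (if i = l then 1 else 0)" if "l \<le> N" for l
  proof -
    have "Polynomial.coeff (p l) n = (- 1 / 2) ^ n * ((- 2) ^ n * Polynomial.coeff (P n $$ (i, l)) n)"
      unfolding p_def coeff_smult by (subst pcompose_affine_coeff[OF deg[OF that]]) auto
    also have "\<dots> = ((- 1 / 2) * (- 2)) ^ n * Polynomial.coeff (P n $$ (i, l)) n"
      unfolding power_mult_distrib by (simp only: mult.assoc)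
    finally show ?thesis using monic_mvop_coeff(1)[OF P i that] by simp
  qed
  have rec: "of_nat (Suc k) \<cdot>\<^sub>v (C_shift N \<alpha> k *\<^sub>v v (Suc k)) = diag_step N \<alpha> n i k *\<^sub>v v k" for k
  proof (rule eq_vecI)
    fix l assume "l < dim_vec (diag_step N \<alpha> n i k *\<^sub>v v k)"
    then have l: "l \<le> N" by (simp add: diag_step_def)
    have "(C_shift N \<alpha> k *\<^sub>v v (Suc k)) $ l
        = (\<Sum>m\<le>N. (of_real (C_entry N g m l) + (if m = l then of_nat k else 0)) * Polynomial.coeff (p m) (Suc k))"
      unfolding mat_vec_entry[OF C_shift_carrier v l]
      using l by (intro sum.cong refl) (simp add: C_shift_entry g_def v_def)
    then have 1: "of_nat (Suc k) * (C_shift N \<alpha> k *\<^sub>v v (Suc k)) $ l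
      = of_nat (Suc k) * (of_nat k * Polynomial.coeff (p l) (Suc k)
      + (\<Sum>m\<le>N. of_real (C_entry N g m l) * Polynomial.coeff (p m) (Suc k)))"
      unfolding sum_single_row[OF l] by (simp only: add.commute)
    have "(diag_step N \<alpha> n i k *\<^sub>v v k) $ l
      = (\<Sum>m\<le>N. (if m = l then of_real (hyp_eig N g n i - hyp_eig N g k l) else 0) * Polynomial.coeff (p m) k)"
      unfolding mat_vec_entry[OF diag_step_carrier v l]
      using l by (intro sum.cong refl) (simp add: diag_step_entry g_def v_def)
    also have "\<dots> = of_real (hyp_eig N g n i - hyp_eig N g k l) * Polynomial.coeff (p l) k"
      by (rule sum_single_row(2)[OF l])
    also have "\<dots> = ((of_nat k)\<^sup>2 + of_nat k * (of_real (U_entry N g l) - 1) + of_real (V_entry N g l)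
        + of_real (hyp_eig N g n i)) * Polynomial.coeff (p l) k"
      by (simp add: hyp_eig_def[of N g k l] power2_eq_square algebra_simps)
    finally have 2: "(diag_step N \<alpha> n i k *\<^sub>v v k) $ l = \<dots>" .
    show "(of_nat (Suc k) \<cdot>\<^sub>v (C_shift N \<alpha> k *\<^sub>v v (Suc k))) $ l
        = (diag_step N \<alpha> n i k *\<^sub>v v k) $ l"
      using eigen_row_recursion[where N=N and g=g and F="mrow P n i" and c="(- 1 / 2) ^ n" and k=k, OF monic_mvop_eigen[OF P i] l] l C_shift_carrier[of N \<alpha> k]
      unfolding p_def[symmetric] 1[symmetric] 2[symmetric] by simp
  qed (simp add: diag_step_def C_shift_def Ct_carrier scalar_mat_def)
  \<comment> \<open>Tirao's recursion with initial value \<open>v 0\<close>.\<close>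
  have v_T: "fact k \<cdot>\<^sub>v v k = T k *\<^sub>v v 0" for k
  proof (induction k)
    case 0
    show ?case unfolding T_def tirao_coeff.simps Ct_carrier(2) using v[of 0] by simp
  next
    case (Suc k)
    let ?C = "C_shift N \<alpha> k" and ?D = "diag_step N \<alpha> n i k"
    note c = C_shift_carrier[of N \<alpha> k] C_shift_inverse(1)[of N \<alpha> k] diag_step_carrier[of N \<alpha> n i k]
    have "v (Suc k) = minv ?C *\<^sub>v (?C *\<^sub>v v (Suc k))"
      using assoc_mult_mat_vec[OF c(2,1) v[of "Suc k"]] unfolding C_shift_inverse(2) using v by simp
    then have "of_nat (Suc k) \<cdot>\<^sub>v v (Suc k) = minv ?C *\<^sub>v (?D *\<^sub>v v k)"
      unfolding rec[symmetric]
      by (metis c(1,2) mult_mat_vec mult_mat_vec_carrier v)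
    then have "fact k \<cdot>\<^sub>v (of_nat (Suc k) \<cdot>\<^sub>v v (Suc k)) = minv ?C *\<^sub>v (?D *\<^sub>v (fact k \<cdot>\<^sub>v v k))"
      by (metis c(2,3) mult_mat_vec mult_mat_vec_carrier v)
    also have "\<dots> = minv ?C *\<^sub>v (?D *\<^sub>v (T k *\<^sub>v v 0))" unfolding Suc ..
    also have "\<dots> = (minv ?C * ?D * T k) *\<^sub>v v 0"
      by (simp only: assoc_mult_mat_vec[OF mult_carrier_mat[OF c(2,3)] T v]
          assoc_mult_mat_vec[OF c(2,3) mult_mat_vec_carrier[OF T v]])
    also have "minv ?C * ?D * T k = T (Suc k)" unfolding T_def by (rule bracket_step[OF i, symmetric])
    finally show ?case by (simp add: smult_smult_assoc mult.commute)
  qed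
  have B: "bracket_n N \<alpha> n i = T n" by (simp add: bracket_n_def T_def)
  have "det (T n) \<noteq> 0"
  proof -
    from inv obtain A where A: "inverts_mat (T n) A" "inverts_mat A (T n)"
      unfolding B invertible_mat_def by blast
    then have "A \<in> carrier_mat (N + 1) (N + 1)"
      using T[of n] unfolding inverts_mat_def
      by (metis carrier_matD(1,2) carrier_matI index_mult_mat(3) index_one_mat(3))
    then have "det (T n) * det A = 1"
      using A(1) T[of n] det_mult[OF T[of n], of A] by (simp add: inverts_mat_def)
    then show ?thesis by auto
  qed
  note Binv = minv_inverse[OF T this]
  have "v n = unit_vec (N + 1) i"
    using p_lead by (intro eq_vecI) (auto simp: v_def unit_vec_def)
  then have "T n *\<^sub>v v 0 = fact n \<cdot>\<^sub>v unit_vec (N + 1) i" using v_T[of n] by simp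
  then have "minv (T n) *\<^sub>v (T n *\<^sub>v v 0) = fact n \<cdot>\<^sub>v (minv (T n) *\<^sub>v unit_vec (N + 1) i)"
    by (simp add: mult_mat_vec[OF Binv(1)])
  \<comment> \<open>The vector in the definition of \<open>hyp_vec\<close> is the value of the row at \<open>u = 0\<close>.\<close>
  then have w: "(fact n \<cdot>\<^sub>m minv (T n)) *\<^sub>v unit_vec (N + 1) i = v 0"
    using assoc_mult_mat_vec[OF Binv(1) T[of n] v[of 0]] v[of 0]
    by (simp only: smult_mat_vec[OF Binv(1) unit_vec_carrier] Binv(2) one_mult_mat_vec)
  have sm: "summable (\<lambda>k. u ^ k / fact k * T k $$ (j, m))" if "m \<le> N" for m
    unfolding T_def by (rule bracket_summable[OF i u j that])
  have "vec_index (hyp_vec N \<alpha> n i u) j = (\<Sum>m\<le>N. (\<Sum>k. u ^ k / fact k * T k $$ (j, m)) * v 0 $ m)"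
    unfolding hyp_vec_def B w tirao_2H1_def T_def[symmetric] Ct_carrier(2) using j v[of 0]
    by (simp add: scalar_prod_def atLeast0LessThan lessThan_Suc_atMost)
  \<comment> \<open>Only the sum over \<open>m\<close> terminates the series; a single entry of the matrix function is
    in general an infinite series, which has to converge before the sums are interchanged.\<close>
  also have "\<dots> = (\<Sum>m\<le>N. \<Sum>k. u ^ k / fact k * T k $$ (j, m) * v 0 $ m)"
    by (intro sum.cong refl suminf_mult2 sm) simp
  also have "\<dots> = (\<Sum>k. \<Sum>m\<le>N. u ^ k / fact k * T k $$ (j, m) * v 0 $ m)"
    by (intro suminf_sum[symmetric] summable_mult2 sm) simp
  also have "\<dots> = (\<Sum>k. Polynomial.coeff (p j) k * u ^ k)"
  proof (rule arg_cong[of _ _ suminf], rule ext)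
    fix k
    have "(\<Sum>m\<le>N. u ^ k / fact k * T k $$ (j, m) * v 0 $ m) = u ^ k / fact k * (T k *\<^sub>v v 0) $ j"
      using T[of k] v[of 0] j
      by (simp add: scalar_prod_def atLeast0LessThan lessThan_Suc_atMost sum_distrib_left mult.assoc)
    also have "\<dots> = Polynomial.coeff (p j) k * u ^ k"
      unfolding v_T[symmetric] using j by (simp add: v_def)
    finally show "(\<Sum>m\<le>N. u ^ k / fact k * T k $$ (j, m) * v 0 $ m) = Polynomial.coeff (p j) k * u ^ k" .
  qed
  also have "\<dots> = (\<Sum>k\<le>degree (p j). Polynomial.coeff (p j) k * u ^ k)"
    by (rule suminf_finite) (auto simp: coeff_eq_0)
  also have "\<dots> = poly (p j) u" by (rule poly_altdef[symmetric])
  finally show ?thesis using R by simp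
qed

text \<open>The coincidences of eigenvalues form a finite set of parameters, so the second part holds because
  the function is equal to its limit in a punctured neighbourhood of \<open>\<alpha>\<close>.\<close>
theorem theorem4p5:
  fixes N :: nat and P :: "nat \<Rightarrow> complex poly mat" and n i j :: nat
    and \<alpha> :: real and u :: complex
  assumes "monic_mvop N P"
    and "i \<le> N" and "j \<le> N"
    and "norm u < 1"
  shows "(invertible_mat (bracket_n N \<alpha> n i) \<longrightarrow>
            R_poly P n u $$ (i, j) = vec_index (hyp_vec N \<alpha> n i u) j)
       \<and> ((\<lambda>\<beta>. vec_index (hyp_vec N \<beta> n i u) j) \<longlongrightarrow> R_poly P n u $$ (i, j)) (at \<alpha>)"
proof
  show "invertible_mat (bracket_n N \<alpha> n i) \<longrightarrow> R_poly P n u $$ (i, j) = vec_index (hyp_vec N \<alpha> n i u) j"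
    using R_poly_eq_hyp_vec[OF assms] by blast
  show "((\<lambda>\<beta>. vec_index (hyp_vec N \<beta> n i u) j) \<longlongrightarrow> R_poly P n u $$ (i, j)) (at \<alpha>)"
  proof (rule tendsto_eventually)
    show "eventually (\<lambda>\<beta>. vec_index (hyp_vec N \<beta> n i u) j = R_poly P n u $$ (i, j)) (at \<alpha>)"
      using eventually_nonresonant[OF assms(2), of n \<alpha>]
      by eventually_elim (use R_poly_eq_hyp_vec[OF assms] in simp)
  qed
qed

end
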